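(* Let $E_{i,j}$ ($i,j\in\mathbb N$) be the standard matrix units in $B(\ell^2(\mathbb N))$, let $\mathcal K_0$ be the norm closed linear span of $\{E_{i,j}:(i,j)\neq(1,1)\}$, and let $\mathcal S_0=\{\lambda I+K_0:\lambda\in\mathbb C,\ K_0\in\mathcal K_0\}\subseteq B(\ell^2(\mathbb N))$ with the operator system structure inherited from $B(\ell^2(\mathbb N))$. Then the bidual $\mathcal S_0^{**}$ is unitally completely order isomorphic to $B(\ell^2(\mathbb N))$.
   Context: The bidual $\mathcal S_0^{**}$ carries its natural operator system structure: its unit is the canonical image of $I$, and its matrix cones are determined by duality with the matrix cones of the dual $\mathcal S_0^*$ (whose positive elements are the positive linear functionals and their matrix analogues). *)

theory Defs
  imports Complex_Main
begin

text \<open>Concrete model of B(l2(N)). Vectors are functions nat => complex; the Hilbert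
space l2 is the set of square-summable ones. Bounded operators are represented
extensionally as maps on all of nat => complex that vanish outside l2.
Indices are 0-based: the distinguished matrix unit E(1,1) of the paper is E 0 0 here.\<close>

type_synonym vec = "nat \<Rightarrow> complex"
type_synonym op = "vec \<Rightarrow> vec"

definition l2 :: "vec set" where
  "l2 = {x. summable (\<lambda>n. (cmod (x n))\<^sup>2)}"

definition l2norm :: "vec \<Rightarrow> real" where
  "l2norm x = sqrt (\<Sum>n. (cmod (x n))\<^sup>2)"

definition inner_l2 :: "vec \<Rightarrow> vec \<Rightarrow> complex" where
  "inner_l2 x y = (\<Sum>n. x n * cnj (y n))"

definition bounded_op :: "op \<Rightarrow> bool" where
  "bounded_op T \<longleftrightarrow>
     (\<forall>x\<in>l2. T x \<in> l2) \<and>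
     (\<forall>x\<in>l2. \<forall>y\<in>l2. \<forall>a b. T (\<lambda>n. a * x n + b * y n) = (\<lambda>n. a * T x n + b * T y n)) \<and>
     (\<exists>C. \<forall>x\<in>l2. l2norm (T x) \<le> C * l2norm x) \<and>
     (\<forall>x. x \<notin> l2 \<longrightarrow> T x = (\<lambda>n. 0))"

definition Bl2 :: "op set" where
  "Bl2 = {T. bounded_op T}"

definition opnorm :: "op \<Rightarrow> real" where
  "opnorm T = Sup {l2norm (T x) | x. x \<in> l2 \<and> l2norm x \<le> 1}"

definition op_add :: "op \<Rightarrow> op \<Rightarrow> op" where
  "op_add S T = (\<lambda>x n. S x n + T x n)"

definition op_scale :: "complex \<Rightarrow> op \<Rightarrow> op" where
  "op_scale c T = (\<lambda>x n. c * T x n)"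

definition op_zero :: op where
  "op_zero = (\<lambda>x n. 0)"

definition idop :: op where
  "idop = (\<lambda>x. if x \<in> l2 then x else (\<lambda>n. 0))"

definition E :: "nat \<Rightarrow> nat \<Rightarrow> op" where
  "E i j = (\<lambda>x. if x \<in> l2 then (\<lambda>n. if n = i then x j else 0) else (\<lambda>n. 0))"

definition lincomb :: "(nat \<times> nat) set \<Rightarrow> (nat \<times> nat \<Rightarrow> complex) \<Rightarrow> op" where
  "lincomb A c = (\<lambda>x n. \<Sum>p\<in>A. c p * E (fst p) (snd p) x n)"

definition K0 :: "op set" where
  "K0 = {T \<in> Bl2. \<forall>\<epsilon>>0. \<exists>A c. finite A \<and> A \<subseteq> {p. p \<noteq> (0,0)} \<and>
          opnorm (op_add T (op_scale (-1) (lincomb A c))) < \<epsilon>}"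

definition S0 :: "op set" where
  "S0 = {op_add (op_scale c idop) K | c K. K \<in> K0}"

definition cnonneg :: "complex \<Rightarrow> bool" where
  "cnonneg z \<longleftrightarrow> Im z = 0 \<and> Re z \<ge> 0"

definition pos_op_matrix :: "nat \<Rightarrow> (nat \<Rightarrow> nat \<Rightarrow> op) \<Rightarrow> bool" where
  "pos_op_matrix n T \<longleftrightarrow> (\<forall>i<n. \<forall>j<n. T i j \<in> Bl2) \<and>
     (\<forall>x. (\<forall>i<n. x i \<in> l2) \<longrightarrow>
        cnonneg (\<Sum>i<n. \<Sum>j<n. inner_l2 (T i j (x j)) (x i)))"

definition pos_S0 :: "nat \<Rightarrow> (nat \<Rightarrow> nat \<Rightarrow> op) \<Rightarrow> bool" where
  "pos_S0 n X \<longleftrightarrow> (\<forall>i<n. \<forall>j<n. X i j \<in> S0) \<and> pos_op_matrix n X"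

definition Dual0 :: "(op \<Rightarrow> complex) set" where
  "Dual0 = {f. (\<forall>S\<in>S0. \<forall>T\<in>S0. \<forall>a b. f (op_add (op_scale a S) (op_scale b T)) = a * f S + b * f T) \<and>
               (\<exists>C. \<forall>S\<in>S0. cmod (f S) \<le> C * opnorm S) \<and>
               (\<forall>S. S \<notin> S0 \<longrightarrow> f S = 0)}"

definition dnorm :: "(op \<Rightarrow> complex) \<Rightarrow> real" where
  "dnorm f = Sup {cmod (f S) | S. S \<in> S0 \<and> opnorm S \<le> 1}"

text \<open>Matrix cones of S0*: (f_ij) is positive iff S \<mapsto> (f_ij(S)) is completely positive.\<close>
definition pos_Dual0 :: "nat \<Rightarrow> (nat \<Rightarrow> nat \<Rightarrow> (op \<Rightarrow> complex)) \<Rightarrow> bool" where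
  "pos_Dual0 n f \<longleftrightarrow> (\<forall>i<n. \<forall>j<n. f i j \<in> Dual0) \<and>
     (\<forall>m X. pos_S0 m X \<longrightarrow>
        (\<forall>v :: nat \<Rightarrow> nat \<Rightarrow> complex.
           cnonneg (\<Sum>i<n. \<Sum>j<n. \<Sum>k<m. \<Sum>l<m. cnj (v i k) * f i j (X k l) * v j l)))"

definition Bidual0 :: "((op \<Rightarrow> complex) \<Rightarrow> complex) set" where
  "Bidual0 = {F. (\<forall>f\<in>Dual0. \<forall>g\<in>Dual0. \<forall>a b. F (\<lambda>S. a * f S + b * g S) = a * F f + b * F g) \<and>
               (\<exists>C. \<forall>f\<in>Dual0. cmod (F f) \<le> C * dnorm f) \<and>
               (\<forall>f. f \<notin> Dual0 \<longrightarrow> F f = 0)}"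

definition pos_Bidual0 :: "nat \<Rightarrow> (nat \<Rightarrow> nat \<Rightarrow> ((op \<Rightarrow> complex) \<Rightarrow> complex)) \<Rightarrow> bool" where
  "pos_Bidual0 n F \<longleftrightarrow> (\<forall>i<n. \<forall>j<n. F i j \<in> Bidual0) \<and>
     (\<forall>m f. pos_Dual0 m f \<longrightarrow>
        (\<forall>v :: nat \<Rightarrow> nat \<Rightarrow> complex.
           cnonneg (\<Sum>i<n. \<Sum>j<n. \<Sum>k<m. \<Sum>l<m. cnj (v i k) * F i j (f k l) * v j l)))"

definition unit_Bidual0 :: "(op \<Rightarrow> complex) \<Rightarrow> complex" where
  "unit_Bidual0 = (\<lambda>f. if f \<in> Dual0 then f idop else 0)"

definition ucoi_Bidual0_Bl2 :: "(((op \<Rightarrow> complex) \<Rightarrow> complex) \<Rightarrow> op) \<Rightarrow> bool" where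
  "ucoi_Bidual0_Bl2 \<Phi> \<longleftrightarrow>
     bij_betw \<Phi> Bidual0 Bl2 \<and>
     (\<forall>F\<in>Bidual0. \<forall>G\<in>Bidual0. \<forall>a b.
        \<Phi> (\<lambda>f. a * F f + b * G f) = op_add (op_scale a (\<Phi> F)) (op_scale b (\<Phi> G))) \<and>
     \<Phi> unit_Bidual0 = idop \<and>
     (\<forall>n F. (\<forall>i<n. \<forall>j<n. F i j \<in> Bidual0) \<longrightarrow>
        (pos_Bidual0 n F \<longleftrightarrow> pos_op_matrix n (\<lambda>i j. \<Phi> (F i j))))"

end

theory Submission
  imports Defs "HOL-Analysis.L2_Norm"
begin

text \<open>Let \<open>P\<^sub>N\<close> be the projection onto the first \<open>N\<close> coordinates. The maps
  \<open>R\<^sub>N(T) = P\<^sub>N T P\<^sub>N + T\<^sub>0\<^sub>0 (I - P\<^sub>N)\<close> are unital, completely positive, take values in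
  \<open>S\<^sub>0\<close>, and converge to the identity in norm on \<open>S\<^sub>0\<close> and weakly on \<open>B(l\<^sup>2)\<close>. For a bounded
  functional \<open>f\<close> on \<open>S\<^sub>0\<close> the limit of \<open>f (R\<^sub>N(T))\<close> exists, uniformly on the unit ball of
  \<open>B(l\<^sup>2)\<close>, because \<open>f\<close> is small on operators supported on far rows or far columns. The
  isomorphism is the inverse of the map sending \<open>T\<close> to \<open>f \<mapsto> lim f (R\<^sub>N(T))\<close>. It is onto since
  \<open>f \<circ> R\<^sub>N \<longrightarrow> f\<close> in the dual norm and \<open>f \<circ> R\<^sub>N\<close> is a combination of coordinate functionals, and it
  preserves positivity in both directions since positive matrices survive \<open>R\<^sub>N\<close> and limits,
  while the vector functionals \<open>S \<mapsto> \<langle>S x\<^sub>j, x\<^sub>i\<rangle>\<close> form a positive matrix over the dual.\<close>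

section \<open>Square-summable sequences\<close>

lemma L2_set_le_l2norm:
  assumes "x \<in> l2" "finite A"
  shows "L2_set (\<lambda>n. cmod (x n)) A \<le> l2norm x"
  using assms unfolding L2_set_def l2norm_def l2_def
  by (auto intro!: real_sqrt_le_mono sum_le_suminf)

lemma l2norm_nonneg: "x \<in> l2 \<Longrightarrow> 0 \<le> l2norm x"
  unfolding l2norm_def l2_def by (auto intro!: suminf_nonneg)

lemma power2_l2norm: "x \<in> l2 \<Longrightarrow> (l2norm x)\<^sup>2 = (\<Sum>n. (cmod (x n))\<^sup>2)"
  unfolding l2norm_def l2_def by (auto intro!: suminf_nonneg)

text \<open>Squares are nonnegative, so bounded finite sections make the series converge, and the
  limit inherits the bound. Square summability and a norm estimate thus come from the same finite
  inequality.\<close>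

lemma l2_boundI:
  assumes "\<And>N. L2_set (\<lambda>n. cmod (x n)) {..<N} \<le> C"
  shows "x \<in> l2" and "l2norm x \<le> C"
proof -
  \<comment> \<open>The empty section has norm 0, which forces \<open>C\<close> to be
    nonnegative.\<close>
  have C: "0 \<le> C" using assms[of 0] by simp
  have le: "(\<Sum>n<N. (cmod (x n))\<^sup>2) \<le> C\<^sup>2" for N
    using assms[of N] C unfolding L2_set_def by (simp add: sqrt_le_D)
  have s: "summable (\<lambda>n. (cmod (x n))\<^sup>2)"
    by (rule summableI_nonneg_bounded[OF _ le]) simp
  then show "x \<in> l2" by (simp add: l2_def)
  show "l2norm x \<le> C"
    unfolding l2norm_def
    by (rule real_le_lsqrt) (use C suminf_le_const[OF s le] in auto)
qed

lemma l2_lincomb_aux: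
  assumes "x \<in> l2" "y \<in> l2"
  shows "L2_set (\<lambda>n. cmod (a * x n + b * y n)) {..<N} \<le> cmod a * l2norm x + cmod b * l2norm y"
proof -
  have "L2_set (\<lambda>n. cmod (a * x n + b * y n)) {..<N}
      \<le> L2_set (\<lambda>n. cmod a * cmod (x n) + cmod b * cmod (y n)) {..<N}"
    by (rule L2_set_mono) (auto intro: norm_triangle_le simp: norm_mult)
  also have "\<dots> \<le> L2_set (\<lambda>n. cmod a * cmod (x n)) {..<N} + L2_set (\<lambda>n. cmod b * cmod (y n)) {..<N}"
    by (rule L2_set_triangle_ineq)
  also have "\<dots> = cmod a * L2_set (\<lambda>n. cmod (x n)) {..<N} + cmod b * L2_set (\<lambda>n. cmod (y n)) {..<N}"
    by (simp add: L2_set_right_distrib)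
  also have "\<dots> \<le> cmod a * l2norm x + cmod b * l2norm y"
    by (intro add_mono mult_left_mono L2_set_le_l2norm assms) auto
  finally show ?thesis .
qed

lemma l2_lincomb: "x \<in> l2 \<Longrightarrow> y \<in> l2 \<Longrightarrow> (\<lambda>n. a * x n + b * y n) \<in> l2"
  by (rule l2_boundI(1)[OF l2_lincomb_aux])

lemma l2norm_lincomb:
  "x \<in> l2 \<Longrightarrow> y \<in> l2 \<Longrightarrow> l2norm (\<lambda>n. a * x n + b * y n) \<le> cmod a * l2norm x + cmod b * l2norm y"
  by (rule l2_boundI(2)[OF l2_lincomb_aux])

lemma l2_zero [simp]: "(\<lambda>n. 0) \<in> l2"
  and l2norm_zero [simp]: "l2norm (\<lambda>n. 0) = 0"
  by (simp_all add: l2_def l2norm_def)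

lemma l2_scale: "x \<in> l2 \<Longrightarrow> (\<lambda>n. a * x n) \<in> l2"
  using l2_lincomb[of x "\<lambda>n. 0" a 0] by simp

lemma l2_add: "x \<in> l2 \<Longrightarrow> y \<in> l2 \<Longrightarrow> (\<lambda>n. x n + y n) \<in> l2"
  using l2_lincomb[of x y 1 1] by simp

lemma l2_sum:
  "(\<And>i. i \<in> A \<Longrightarrow> x i \<in> l2) \<Longrightarrow> (\<lambda>n. \<Sum>i\<in>A. a i * x i n) \<in> l2"
proof (induction A rule: infinite_finite_induct)
  case (insert i A)
  then show ?case using l2_lincomb[of "x i" "\<lambda>n. \<Sum>i\<in>A. a i * x i n" "a i" 1] by simp
qed auto

lemma l2norm_scale:
  assumes "x \<in> l2"
  shows "l2norm (\<lambda>n. a * x n) = cmod a * l2norm x"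
proof -
  have "(\<Sum>n. (cmod (a * x n))\<^sup>2) = (cmod a)\<^sup>2 * (\<Sum>n. (cmod (x n))\<^sup>2)"
    using assms by (simp add: norm_mult power_mult_distrib l2_def suminf_mult)
  then show ?thesis by (simp add: l2norm_def real_sqrt_mult)
qed

lemma l2norm_add: "x \<in> l2 \<Longrightarrow> y \<in> l2 \<Longrightarrow> l2norm (\<lambda>n. x n + y n) \<le> l2norm x + l2norm y"
  using l2norm_lincomb[of x y 1 1] by simp

lemma l2norm_component: "x \<in> l2 \<Longrightarrow> cmod (x n) \<le> l2norm x"
  using L2_set_le_l2norm[of x "{n}"] by simp

section \<open>Basis vectors and coordinate projections\<close>

definition basis_vec :: "nat \<Rightarrow> vec" where
  "basis_vec i = (\<lambda>n. if n = i then 1 else 0)"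

lemma sums_basis_vec: "(\<lambda>n. (cmod (basis_vec i n))\<^sup>2) sums 1"
proof -
  have "(\<lambda>n. (cmod (basis_vec i n))\<^sup>2) = (\<lambda>n. if n = i then 1 else 0)"
    by (auto simp: basis_vec_def)
  then show ?thesis using sums_single[of i "\<lambda>_. 1::real"] by simp
qed

lemma basis_vec_l2 [simp]: "basis_vec i \<in> l2"
  and l2norm_basis_vec [simp]: "l2norm (basis_vec i) = 1"
  using sums_basis_vec[of i] by (auto simp: l2_def l2norm_def sums_iff)

text \<open>The orthogonal projection onto the coordinates in \<open>I\<close>, kept as a map on all
  sequences rather than as an element of \<open>Bl2\<close>, so that its algebra carries no
  membership conditions.\<close>

definition vcut :: "nat set \<Rightarrow> vec \<Rightarrow> vec" where
  "vcut I x = (\<lambda>n. if n \<in> I then x n else 0)"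

lemma vcut_l2 [simp]: "x \<in> l2 \<Longrightarrow> vcut I x \<in> l2"
  unfolding l2_def vcut_def
  by (auto intro: summable_comparison_test_ev[of _ "\<lambda>n. (cmod (x n))\<^sup>2"])

lemma vcut_lincomb: "vcut I (\<lambda>n. a * x n + b * y n) = (\<lambda>n. a * vcut I x n + b * vcut I y n)"
  by (auto simp: vcut_def)

lemma vcut_vcut: "vcut I (vcut J x) = vcut (I \<inter> J) x"
  by (auto simp: vcut_def)

lemma vcut_zero [simp]: "vcut I (\<lambda>n. 0) = (\<lambda>n. 0)"
  by (auto simp: vcut_def)

text \<open>Pythagoras for vectors with disjoint supports, the source of the \<open>sqrt\<close>
  bounds for sums of block operators.\<close>

lemma l2norm_vcut_split:
  assumes "x \<in> l2" "I \<inter> J = {}"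
  shows "(l2norm (vcut I x))\<^sup>2 + (l2norm (vcut J x))\<^sup>2 = (l2norm (vcut (I \<union> J) x))\<^sup>2"
proof -
  have "(l2norm (vcut (I \<union> J) x))\<^sup>2 = (\<Sum>n. (cmod (vcut I x n))\<^sup>2 + (cmod (vcut J x n))\<^sup>2)"
    using assms(2) unfolding power2_l2norm[OF vcut_l2[OF assms(1)]]
    by (intro suminf_cong) (auto simp: vcut_def)
  also have "\<dots> = (l2norm (vcut I x))\<^sup>2 + (l2norm (vcut J x))\<^sup>2"
    using assms by (simp add: power2_l2norm suminf_add vcut_l2[unfolded l2_def, simplified] l2_def)
  finally show ?thesis by simp
qed

lemma vcut_UNIV [simp]: "vcut UNIV x = x"
  by (simp add: vcut_def)

lemma l2norm_vcut_Compl: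
  assumes "x \<in> l2"
  shows "(l2norm (vcut I x))\<^sup>2 + (l2norm (vcut (- I) x))\<^sup>2 = (l2norm x)\<^sup>2"
  using l2norm_vcut_split[OF assms, of I "- I"] by (simp add: Compl_partition)

lemma l2norm_vcut_le: "x \<in> l2 \<Longrightarrow> l2norm (vcut I x) \<le> l2norm x"
  using l2norm_vcut_Compl[of x I]
  by (metis l2norm_nonneg le_add_same_cancel1 power2_le_imp_le zero_le_power2)

text \<open>The square of the tail norm is the remainder of a convergent series.\<close>

lemma l2norm_vcut_tail_tendsto:
  assumes "x \<in> l2"
  shows "(\<lambda>N. l2norm (vcut {N..} x)) \<longlonglongrightarrow> 0"
proof -
  have s: "summable (\<lambda>n. (cmod (x n))\<^sup>2)" using assms by (simp add: l2_def)
  have "(l2norm (vcut {N..} x))\<^sup>2 = (\<Sum>n. (cmod (x n))\<^sup>2) - (\<Sum>n<N. (cmod (x n))\<^sup>2)" for N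
  proof -
    have "(l2norm (vcut {..<N} x))\<^sup>2 = (\<Sum>n. if n \<in> {..<N} then (cmod (x n))\<^sup>2 else 0)"
      unfolding power2_l2norm[OF vcut_l2[OF assms]] by (intro suminf_cong) (auto simp: vcut_def)
    also have "\<dots> = (\<Sum>n<N. (cmod (x n))\<^sup>2)"
      by (subst suminf_finite[of "{..<N}"]) auto
    finally show ?thesis
      using l2norm_vcut_Compl[OF assms, of "{..<N}"] power2_l2norm[OF assms]
      by (simp add: Compl_lessThan)
  qed
  then have eq: "l2norm (vcut {N..} x) = sqrt ((\<Sum>n. (cmod (x n))\<^sup>2) - (\<Sum>n<N. (cmod (x n))\<^sup>2))" for N
    using assms by (metis vcut_l2 l2norm_nonneg real_sqrt_unique)
  have "(\<lambda>N. sqrt ((\<Sum>n. (cmod (x n))\<^sup>2) - (\<Sum>n<N. (cmod (x n))\<^sup>2))) \<longlonglongrightarrow>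
      sqrt ((\<Sum>n. (cmod (x n))\<^sup>2) - (\<Sum>n. (cmod (x n))\<^sup>2))"
    by (intro tendsto_intros summable_LIMSEQ s)
  then show ?thesis by (simp add: eq)
qed

section \<open>The inner product\<close>

lemma
  assumes "x \<in> l2" "y \<in> l2"
  shows summable_inner: "summable (\<lambda>n. x n * cnj (y n))"
    and inner_l2_Cauchy_Schwarz: "cmod (inner_l2 x y) \<le> l2norm x * l2norm y"
proof -
  \<comment> \<open>Cauchy-Schwarz on finite sections bounds the series of absolute values, which
    yields summability and the inequality together.\<close>
  have b: "(\<Sum>n<N. cmod (x n * cnj (y n))) \<le> l2norm x * l2norm y" for N
  proof -
    have "(\<Sum>n<N. cmod (x n * cnj (y n))) \<le> L2_set (\<lambda>n. cmod (x n)) {..<N} * L2_set (\<lambda>n. cmod (y n)) {..<N}"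
      using L2_set_mult_ineq[of "\<lambda>n. cmod (x n)" "\<lambda>n. cmod (y n)" "{..<N}"] by (simp add: norm_mult)
    also have "\<dots> \<le> l2norm x * l2norm y"
      by (intro mult_mono L2_set_le_l2norm assms l2norm_nonneg) auto
    finally show ?thesis .
  qed
  have s: "summable (\<lambda>n. cmod (x n * cnj (y n)))"
    by (rule summableI_nonneg_bounded[OF _ b]) simp
  then show "summable (\<lambda>n. x n * cnj (y n))" by (rule summable_norm_cancel)
  show "cmod (inner_l2 x y) \<le> l2norm x * l2norm y"
    unfolding inner_l2_def
    using summable_norm[OF s] suminf_le_const[OF s b] by linarith
qed

lemma inner_l2_lincomb_left:
  assumes "x \<in> l2" "x' \<in> l2" "y \<in> l2"
  shows "inner_l2 (\<lambda>n. a * x n + b * x' n) y = a * inner_l2 x y + b * inner_l2 x' y"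
proof -
  have "inner_l2 (\<lambda>n. a * x n + b * x' n) y = (\<Sum>n. a * (x n * cnj (y n)) + b * (x' n * cnj (y n)))"
    unfolding inner_l2_def by (simp add: algebra_simps)
  also have "\<dots> = a * inner_l2 x y + b * inner_l2 x' y"
    unfolding inner_l2_def
    by (simp add: suminf_add[symmetric] suminf_mult summable_inner summable_mult assms)
  finally show ?thesis .
qed

lemma cnj_inner_l2: "x \<in> l2 \<Longrightarrow> y \<in> l2 \<Longrightarrow> cnj (inner_l2 x y) = inner_l2 y x"
  using sums_cnj[THEN iffD2, OF summable_sums[OF summable_inner[of x y]]]
  by (simp add: inner_l2_def sums_iff mult.commute)

lemma inner_l2_lincomb_right:
  assumes "x \<in> l2" "y \<in> l2" "y' \<in> l2"
  shows "inner_l2 x (\<lambda>n. a * y n + b * y' n) = cnj a * inner_l2 x y + cnj b * inner_l2 x y'"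
proof -
  have "inner_l2 x (\<lambda>n. a * y n + b * y' n) = cnj (inner_l2 (\<lambda>n. a * y n + b * y' n) x)"
    using assms by (simp add: cnj_inner_l2 l2_lincomb)
  also have "\<dots> = cnj a * inner_l2 x y + cnj b * inner_l2 x y'"
    using assms by (simp add: inner_l2_lincomb_left cnj_inner_l2)
  finally show ?thesis .
qed

lemma inner_l2_sum_left:
  assumes "y \<in> l2"
  shows "(\<And>i. i \<in> A \<Longrightarrow> x i \<in> l2) \<Longrightarrow>
    inner_l2 (\<lambda>n. \<Sum>i\<in>A. a i * x i n) y = (\<Sum>i\<in>A. a i * inner_l2 (x i) y)"
proof (induction A rule: infinite_finite_induct)
  case (insert i A)
  then show ?case
    using inner_l2_lincomb_left[of "x i" "\<lambda>n. \<Sum>i\<in>A. a i * x i n" y "a i" 1] assms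
    by (simp add: l2_sum)
qed (auto simp: inner_l2_def)

lemma inner_l2_sum_right:
  assumes "x \<in> l2" "\<And>i. i \<in> A \<Longrightarrow> y i \<in> l2"
  shows "inner_l2 x (\<lambda>n. \<Sum>i\<in>A. a i * y i n) = (\<Sum>i\<in>A. cnj (a i) * inner_l2 x (y i))"
proof -
  have "inner_l2 x (\<lambda>n. \<Sum>i\<in>A. a i * y i n) = cnj (inner_l2 (\<lambda>n. \<Sum>i\<in>A. a i * y i n) x)"
    using assms by (simp add: cnj_inner_l2 l2_sum)
  also have "\<dots> = (\<Sum>i\<in>A. cnj (a i) * inner_l2 x (y i))"
    using assms by (simp add: inner_l2_sum_left cnj_inner_l2)
  finally show ?thesis .
qed

lemma inner_l2_basis_vec: "inner_l2 x (basis_vec n) = x n"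
proof -
  have "(\<lambda>k. x k * cnj (basis_vec n k)) = (\<lambda>k. if k = n then x k else 0)"
    by (auto simp: basis_vec_def)
  then show ?thesis
    unfolding inner_l2_def using sums_single[of n x] by (simp add: sums_iff)
qed

lemma inner_l2_vcut: "inner_l2 (vcut I x) y = inner_l2 x (vcut I y)"
  unfolding inner_l2_def by (rule suminf_cong) (auto simp: vcut_def)

section \<open>Bounded operators\<close>

lemma Bl2I:
  assumes "\<And>x. x \<in> l2 \<Longrightarrow> T x \<in> l2"
    and "\<And>x y a b. x \<in> l2 \<Longrightarrow> y \<in> l2 \<Longrightarrow>
      T (\<lambda>n. a * x n + b * y n) = (\<lambda>n. a * T x n + b * T y n)"
    and "\<And>x. x \<in> l2 \<Longrightarrow> l2norm (T x) \<le> C * l2norm x"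
    and "\<And>x. x \<notin> l2 \<Longrightarrow> T x = (\<lambda>n. 0)"
  shows "T \<in> Bl2"
  using assms unfolding Bl2_def bounded_op_def by blast

lemma Bl2_outside: "T \<in> Bl2 \<Longrightarrow> x \<notin> l2 \<Longrightarrow> T x = (\<lambda>n. 0)"
  by (simp add: Bl2_def bounded_op_def)

text \<open>Outside \<open>l2\<close> the value is the zero sequence, so no condition on
  \<open>x\<close> has to be discharged when this is used for rewriting.\<close>

lemma Bl2_l2 [simp]: "T \<in> Bl2 \<Longrightarrow> T x \<in> l2"
  by (cases "x \<in> l2") (simp_all add: Bl2_def bounded_op_def)

lemma Bl2_lincomb:
  "T \<in> Bl2 \<Longrightarrow> x \<in> l2 \<Longrightarrow> y \<in> l2 \<Longrightarrow> T (\<lambda>n. a * x n + b * y n) = (\<lambda>n. a * T x n + b * T y n)"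
  unfolding Bl2_def bounded_op_def by blast

lemma Bl2_bounded:
  assumes "T \<in> Bl2"
  obtains C where "\<And>x. x \<in> l2 \<Longrightarrow> l2norm (T x) \<le> C * l2norm x"
  using assms unfolding Bl2_def bounded_op_def by blast

lemma Bl2_scale: "T \<in> Bl2 \<Longrightarrow> x \<in> l2 \<Longrightarrow> T (\<lambda>n. a * x n) = (\<lambda>n. a * T x n)"
  using Bl2_lincomb[of T x "\<lambda>n. 0" a 0] by simp

lemma Bl2_zero: "T \<in> Bl2 \<Longrightarrow> T (\<lambda>n. 0) = (\<lambda>n. 0)"
  using Bl2_scale[of T "\<lambda>n. 0" 0] by simp

lemma Bl2_sum:
  assumes "T \<in> Bl2"
  shows "(\<And>i. i \<in> A \<Longrightarrow> x i \<in> l2) \<Longrightarrow>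
    T (\<lambda>n. \<Sum>i\<in>A. a i * x i n) = (\<lambda>n. \<Sum>i\<in>A. a i * T (x i) n)"
proof (induction A rule: infinite_finite_induct)
  case (insert i A)
  then show ?case
    using Bl2_lincomb[OF assms, of "x i" "\<lambda>n. \<Sum>i\<in>A. a i * x i n" "a i" 1] by (simp add: l2_sum)
qed (auto simp: Bl2_zero[OF assms])

section \<open>The operator norm\<close>

lemma opnorm_upper:
  assumes "T \<in> Bl2" "x \<in> l2" "l2norm x \<le> 1"
  shows "l2norm (T x) \<le> opnorm T"
proof -
  obtain C where C: "\<And>x. x \<in> l2 \<Longrightarrow> l2norm (T x) \<le> C * l2norm x"
    using Bl2_bounded[OF assms(1)] by blast
  have "l2norm (T x) \<le> \<bar>C\<bar>" if "x \<in> l2" "l2norm x \<le> 1" for x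
  proof -
    have "l2norm (T x) \<le> \<bar>C\<bar> * l2norm x"
      using C[OF that(1)] l2norm_nonneg[OF that(1)] by (meson abs_ge_self mult_right_mono order_trans)
    also have "\<dots> \<le> \<bar>C\<bar>" using that(2) by (simp add: mult_left_le)
    finally show ?thesis .
  qed
  then have "bdd_above {l2norm (T x) | x. x \<in> l2 \<and> l2norm x \<le> 1}"
    by (auto intro!: bdd_aboveI[of _ "\<bar>C\<bar>"])
  then show ?thesis
    unfolding opnorm_def using assms by (auto intro!: cSup_upper)
qed

lemma opnorm_nonneg: "T \<in> Bl2 \<Longrightarrow> 0 \<le> opnorm T"
  using opnorm_upper[of T "\<lambda>n. 0"] by (simp add: Bl2_zero)

lemma l2norm_apply_le:
  assumes "T \<in> Bl2" "x \<in> l2"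
  shows "l2norm (T x) \<le> opnorm T * l2norm x"
proof (cases "l2norm x = 0")
  \<comment> \<open>A vector of norm 0 cannot be normalised, but any bound for \<open>T\<close>
    already makes the norm of \<open>T x\<close> at most 0.\<close>
  case True
  obtain C where "\<And>x. x \<in> l2 \<Longrightarrow> l2norm (T x) \<le> C * l2norm x"
    using Bl2_bounded[OF assms(1)] by blast
  from this[OF assms(2)] True show ?thesis by simp
next
  case False
  then have p: "0 < l2norm x" using l2norm_nonneg[OF assms(2)] by simp
  let ?c = "complex_of_real (1 / l2norm x)"
  have "l2norm (T (\<lambda>n. ?c * x n)) \<le> opnorm T"
    using p assms(2) by (intro opnorm_upper assms l2_scale) (simp_all only: l2norm_scale, simp add: norm_divide)
  moreover have "l2norm (T (\<lambda>n. ?c * x n)) = l2norm (T x) / l2norm x"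
    unfolding Bl2_scale[OF assms] using p assms by (simp only: l2norm_scale Bl2_l2) (simp add: norm_divide)
  ultimately show ?thesis using p by (simp add: divide_le_eq)
qed

lemma opnorm_least:
  assumes "\<And>x. x \<in> l2 \<Longrightarrow> l2norm (T x) \<le> C * l2norm x" "0 \<le> C"
  shows "opnorm T \<le> C"
  unfolding opnorm_def
proof (rule cSup_least)
  show "{l2norm (T x) | x. x \<in> l2 \<and> l2norm x \<le> 1} \<noteq> {}"
    by (auto intro!: exI[of _ "\<lambda>n. 0"])
  fix r assume "r \<in> {l2norm (T x) | x. x \<in> l2 \<and> l2norm x \<le> 1}"
  then show "r \<le> C" using assms mult_left_mono[of _ 1 C] by force
qed

lemma
  assumes "S \<in> Bl2" "T \<in> Bl2"
  shows op_add_Bl2 [simp]: "op_add S T \<in> Bl2"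
    and opnorm_add: "opnorm (op_add S T) \<le> opnorm S + opnorm T"
proof -
  have b: "l2norm (op_add S T x) \<le> (opnorm S + opnorm T) * l2norm x" if "x \<in> l2" for x
    using l2norm_add[of "S x" "T x"] l2norm_apply_le[OF assms(1) that] l2norm_apply_le[OF assms(2) that] assms
    by (simp add: op_add_def algebra_simps)
  show "op_add S T \<in> Bl2"
    by (rule Bl2I[OF _ _ b])
      (use assms in \<open>auto simp: op_add_def l2_add Bl2_lincomb[OF assms(1)] Bl2_lincomb[OF assms(2)]
        Bl2_outside[OF assms(1)] Bl2_outside[OF assms(2)] algebra_simps\<close>)
  show "opnorm (op_add S T) \<le> opnorm S + opnorm T"
    by (rule opnorm_least[OF b]) (use assms opnorm_nonneg in auto)
qed

lemma
  assumes "T \<in> Bl2"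
  shows op_scale_Bl2 [simp]: "op_scale c T \<in> Bl2"
    and opnorm_scale_le: "opnorm (op_scale c T) \<le> cmod c * opnorm T"
proof -
  have b: "l2norm (op_scale c T x) \<le> (cmod c * opnorm T) * l2norm x" if "x \<in> l2" for x
    using l2norm_apply_le[OF assms(1) that] assms
    by (simp add: op_scale_def l2norm_scale mult.assoc mult_left_mono)
  show "op_scale c T \<in> Bl2"
    by (rule Bl2I[OF _ _ b])
      (use assms in \<open>auto simp: op_scale_def l2_scale Bl2_lincomb[OF assms] Bl2_outside[OF assms] algebra_simps\<close>)
  show "opnorm (op_scale c T) \<le> cmod c * opnorm T"
    by (rule opnorm_least[OF b]) (use assms opnorm_nonneg in auto)
qed

lemma op_scale_op_scale [simp]: "op_scale a (op_scale b T) = op_scale (a * b) T"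
  by (simp add: op_scale_def mult.assoc)

lemma op_scale_one [simp]: "op_scale 1 T = T"
  by (simp add: op_scale_def)

lemma op_scale_op_add: "op_scale a (op_add S T) = op_add (op_scale a S) (op_scale a T)"
  by (simp add: op_scale_def op_add_def algebra_simps)

text \<open>The reverse inequality is \<open>opnorm_scale_le\<close> for the scalar
  \<open>1 / c\<close> applied to \<open>op_scale c T\<close>.\<close>

lemma opnorm_scale:
  assumes "T \<in> Bl2"
  shows "opnorm (op_scale c T) = cmod c * opnorm T"
proof (cases "c = 0")
  case True
  then show ?thesis
    using opnorm_scale_le[OF assms, of c] opnorm_nonneg[OF op_scale_Bl2[OF assms], of c] by simp
next
  case False
  have "opnorm T \<le> cmod (1 / c) * opnorm (op_scale c T)"
    using opnorm_scale_le[of "op_scale c T" "1 / c"] assms False by simp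
  then show ?thesis
    using opnorm_scale_le[OF assms, of c] False by (simp add: norm_divide field_simps)
qed

lemma op_zero_Bl2 [simp]: "op_zero \<in> Bl2"
  by (rule Bl2I[of _ 0]) (auto simp: op_zero_def)

lemma opnorm_zero [simp]: "opnorm op_zero = 0"
  using opnorm_scale[OF op_zero_Bl2, of 0] by (simp add: op_scale_def op_zero_def)

lemma idop_Bl2 [simp]: "idop \<in> Bl2"
  by (rule Bl2I[of _ 1]) (auto simp: idop_def l2_lincomb)

lemma opnorm_idop_le: "opnorm idop \<le> 1"
  by (rule opnorm_least) (auto simp: idop_def)

section \<open>Matrix units, their closed span and the operator system\<close>

lemma E_Bl2 [simp]: "E i j \<in> Bl2"
proof (rule Bl2I[of _ 1])
  fix x assume x: "x \<in> l2"
  have E: "E i j x = (\<lambda>n. x j * basis_vec i n)" using x by (auto simp: E_def basis_vec_def)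
  show "E i j x \<in> l2" unfolding E by (simp add: l2_scale)
  show "l2norm (E i j x) \<le> 1 * l2norm x"
    unfolding E by (simp add: l2norm_scale l2norm_component x)
qed (auto simp: E_def l2_lincomb)

lemma lincomb_empty: "lincomb {} c = op_zero"
  by (simp add: lincomb_def op_zero_def)

lemma lincomb_insert:
  "finite A \<Longrightarrow> p \<notin> A \<Longrightarrow>
    lincomb (insert p A) c = op_add (op_scale (c p) (E (fst p) (snd p))) (lincomb A c)"
  by (simp add: lincomb_def op_add_def op_scale_def)

lemma lincomb_Bl2 [simp]: "finite A \<Longrightarrow> lincomb A c \<in> Bl2"
  by (induction A rule: finite_induct) (simp_all add: lincomb_empty lincomb_insert)

text \<open>Extending both coefficient families by zero to the union of the supports keeps the sum
  in the form that \<open>K0\<close> asks for.\<close>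

lemma lincomb_add:
  assumes "finite A" "finite B"
  shows "op_add (lincomb A c) (lincomb B d) =
    lincomb (A \<union> B) (\<lambda>p. (if p \<in> A then c p else 0) + (if p \<in> B then d p else 0))"
proof (intro ext)
  fix x n
  let ?e = "\<lambda>p. E (fst p) (snd p) x n"
  have "(\<Sum>p\<in>A. c p * ?e p) = (\<Sum>p\<in>A \<union> B. if p \<in> A then c p * ?e p else 0)"
    using assms by (intro sum.mono_neutral_cong_left) auto
  moreover have "(\<Sum>p\<in>B. d p * ?e p) = (\<Sum>p\<in>A \<union> B. if p \<in> B then d p * ?e p else 0)"
    using assms by (intro sum.mono_neutral_cong_left) auto
  ultimately show "op_add (lincomb A c) (lincomb B d) x n =
    lincomb (A \<union> B) (\<lambda>p. (if p \<in> A then c p else 0) + (if p \<in> B then d p else 0)) x n"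
    by (auto simp: op_add_def lincomb_def sum.distrib[symmetric] intro!: sum.cong simp: algebra_simps)
qed

lemma op_scale_lincomb: "op_scale a (lincomb A c) = lincomb A (\<lambda>p. a * c p)"
  by (simp add: op_scale_def lincomb_def sum_distrib_left mult.assoc)

lemma K0_Bl2 [simp]: "K \<in> K0 \<Longrightarrow> K \<in> Bl2"
  by (simp add: K0_def)

lemma K0_approx:
  assumes "K \<in> K0" "0 < \<epsilon>"
  obtains A c where "finite A" "(0, 0) \<notin> A" "opnorm (op_add K (op_scale (-1) (lincomb A c))) < \<epsilon>"
  using assms unfolding K0_def by blast

lemma K0I:
  assumes "K \<in> Bl2"
    and "\<And>\<epsilon>. 0 < \<epsilon> \<Longrightarrow> \<exists>A c. finite A \<and> (0, 0) \<notin> A \<and> opnorm (op_add K (op_scale (-1) (lincomb A c))) < \<epsilon>"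
  shows "K \<in> K0"
proof -
  have "A \<subseteq> {p. p \<noteq> (0, 0)} \<longleftrightarrow> (0, 0) \<notin> A" for A :: "(nat \<times> nat) set" by blast
  then show ?thesis using assms unfolding K0_def by simp
qed

lemma lincomb_K0:
  assumes "finite A" "(0, 0) \<notin> A"
  shows "lincomb A c \<in> K0"
proof (rule K0I)
  have "op_add (lincomb A c) (op_scale (-1) (lincomb A c)) = op_zero"
    by (simp add: op_add_def op_scale_def op_zero_def)
  then show "\<exists>B d. finite B \<and> (0, 0) \<notin> B \<and> opnorm (op_add (lincomb A c) (op_scale (-1) (lincomb B d))) < \<epsilon>"
    if "0 < \<epsilon>" for \<epsilon>
    using assms that by (metis opnorm_zero)
qed (simp add: assms)

lemma K0_add:
  assumes "K \<in> K0" "L \<in> K0"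
  shows "op_add K L \<in> K0"
proof (rule K0I)
  fix \<epsilon> :: real assume e: "0 < \<epsilon>"
  obtain A c where A: "finite A" "(0, 0) \<notin> A" "opnorm (op_add K (op_scale (-1) (lincomb A c))) < \<epsilon> / 2"
    using K0_approx[OF assms(1), of "\<epsilon> / 2"] e by auto
  obtain B d where B: "finite B" "(0, 0) \<notin> B" "opnorm (op_add L (op_scale (-1) (lincomb B d))) < \<epsilon> / 2"
    using K0_approx[OF assms(2), of "\<epsilon> / 2"] e by auto
  have "op_add (op_add K L) (op_scale (-1) (op_add (lincomb A c) (lincomb B d))) =
      op_add (op_add K (op_scale (-1) (lincomb A c))) (op_add L (op_scale (-1) (lincomb B d)))"
    by (simp add: op_add_def op_scale_def algebra_simps)
  moreover have "opnorm (op_add (op_add K (op_scale (-1) (lincomb A c))) (op_add L (op_scale (-1) (lincomb B d)))) < \<epsilon>"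
    using opnorm_add[of "op_add K (op_scale (-1) (lincomb A c))" "op_add L (op_scale (-1) (lincomb B d))"]
      A B assms by simp
  ultimately have "opnorm (op_add (op_add K L) (op_scale (-1) (op_add (lincomb A c) (lincomb B d)))) < \<epsilon>"
    by simp
  then show "\<exists>A c. finite A \<and> (0, 0) \<notin> A \<and> opnorm (op_add (op_add K L) (op_scale (-1) (lincomb A c))) < \<epsilon>"
    unfolding lincomb_add[OF A(1) B(1)]
    using A(1,2) B(1,2) by blast
qed (simp add: assms)

lemma K0_scale:
  assumes "K \<in> K0"
  shows "op_scale a K \<in> K0"
proof (rule K0I)
  fix \<epsilon> :: real assume e: "0 < \<epsilon>"
  \<comment> \<open>The added 1 keeps the denominator positive when \<open>a = 0\<close>.\<close>
  have p: "0 < cmod a + 1" by (simp add: add_nonneg_pos)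
  obtain A c where A: "finite A" "(0, 0) \<notin> A"
      "opnorm (op_add K (op_scale (-1) (lincomb A c))) < \<epsilon> / (cmod a + 1)"
    using K0_approx[OF assms(1), of "\<epsilon> / (cmod a + 1)"] e p by auto
  have "op_add (op_scale a K) (op_scale (-1) (lincomb A (\<lambda>p. a * c p))) =
      op_scale a (op_add K (op_scale (-1) (lincomb A c)))"
    by (simp add: op_scale_op_add op_scale_lincomb)
  then have "opnorm (op_add (op_scale a K) (op_scale (-1) (lincomb A (\<lambda>p. a * c p)))) =
      cmod a * opnorm (op_add K (op_scale (-1) (lincomb A c)))"
    using A assms by (simp add: opnorm_scale)
  also have "\<dots> \<le> (cmod a + 1) * opnorm (op_add K (op_scale (-1) (lincomb A c)))"
    using A assms by (intro mult_right_mono opnorm_nonneg) auto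
  also have "\<dots> < \<epsilon>" using A(3) p by (simp add: field_simps)
  finally show "\<exists>A c. finite A \<and> (0, 0) \<notin> A \<and> opnorm (op_add (op_scale a K) (op_scale (-1) (lincomb A c))) < \<epsilon>"
    using A(1,2) by blast
qed (simp add: assms)

lemma op_zero_K0: "op_zero \<in> K0"
  using lincomb_K0[of "{}" undefined] by (simp add: lincomb_empty)

lemma S0E:
  assumes "S \<in> S0"
  obtains c K where "S = op_add (op_scale c idop) K" "K \<in> K0"
  using assms by (auto simp: S0_def)

lemma S0_Bl2 [simp]: "S \<in> S0 \<Longrightarrow> S \<in> Bl2"
  by (auto elim: S0E)

lemma S0I: "K \<in> K0 \<Longrightarrow> op_add (op_scale c idop) K \<in> S0"
  by (auto simp: S0_def)

lemma K0_S0: "K \<in> K0 \<Longrightarrow> K \<in> S0"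
  using S0I[of K 0] by (simp add: op_add_def op_scale_def)

lemma idop_S0: "idop \<in> S0"
  using S0I[OF op_zero_K0, of 1] by (simp add: op_add_def op_zero_def)

lemma S0_add:
  assumes "S \<in> S0" "T \<in> S0"
  shows "op_add S T \<in> S0"
proof -
  obtain c K where S: "S = op_add (op_scale c idop) K" "K \<in> K0" using assms(1) by (rule S0E)
  obtain d L where T: "T = op_add (op_scale d idop) L" "L \<in> K0" using assms(2) by (rule S0E)
  have "op_add S T = op_add (op_scale (c + d) idop) (op_add K L)"
    by (simp add: S T op_add_def op_scale_def algebra_simps)
  then show ?thesis using S T by (simp add: S0I K0_add)
qed

lemma S0_scale:
  assumes "S \<in> S0"
  shows "op_scale a S \<in> S0"
proof -
  obtain c K where S: "S = op_add (op_scale c idop) K" "K \<in> K0" using assms(1) by (rule S0E)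
  have "op_scale a S = op_add (op_scale (a * c) idop) (op_scale a K)"
    by (simp add: S op_scale_op_add)
  then show ?thesis using S by (simp add: S0I K0_scale)
qed

section \<open>Compressions and block operators\<close>

definition compress :: "nat set \<Rightarrow> nat set \<Rightarrow> op \<Rightarrow> op" where
  "compress I J T = (\<lambda>x. if x \<in> l2 then vcut I (T (vcut J x)) else (\<lambda>n. 0))"

lemma
  assumes "T \<in> Bl2"
  shows compress_Bl2 [simp]: "compress I J T \<in> Bl2"
    and opnorm_compress: "opnorm (compress I J T) \<le> opnorm T"
proof -
  have b: "l2norm (compress I J T x) \<le> opnorm T * l2norm x" if x: "x \<in> l2" for x
  proof -
    have "l2norm (compress I J T x) \<le> l2norm (T (vcut J x))"
      using x assms by (simp add: compress_def l2norm_vcut_le)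
    also have "\<dots> \<le> opnorm T * l2norm (vcut J x)"
      using x assms by (simp add: l2norm_apply_le)
    also have "\<dots> \<le> opnorm T * l2norm x"
      using x assms by (simp add: l2norm_vcut_le mult_left_mono opnorm_nonneg)
    finally show ?thesis .
  qed
  show "compress I J T \<in> Bl2"
    by (rule Bl2I[OF _ _ b]) (use assms in \<open>auto simp: compress_def l2_lincomb vcut_lincomb Bl2_lincomb[OF assms]\<close>)
  show "opnorm (compress I J T) \<le> opnorm T"
    by (rule opnorm_least[OF b]) (use assms opnorm_nonneg in auto)
qed

text \<open>Operators whose matrix is supported on \<open>I \<times> J\<close>, with
  \<open>I\<close> the rows and \<open>J\<close> the columns. The column condition is restricted to
  \<open>l2\<close> because \<open>vcut J x\<close> may lie in \<open>l2\<close> although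
  \<open>x\<close> does not.\<close>

definition blocks :: "nat set \<Rightarrow> nat set \<Rightarrow> op set" where
  "blocks I J = {K \<in> Bl2. (\<forall>x. vcut I (K x) = K x) \<and> (\<forall>x\<in>l2. K (vcut J x) = K x)}"

lemma blocksI:
  assumes "K \<in> Bl2" "\<And>x n. x \<in> l2 \<Longrightarrow> n \<notin> I \<Longrightarrow> K x n = 0" "\<And>x. x \<in> l2 \<Longrightarrow> K (vcut J x) = K x"
  shows "K \<in> blocks I J"
proof -
  have "vcut I (K x) = K x" for x
    using assms(2)[of x] Bl2_outside[OF assms(1), of x] by (cases "x \<in> l2") (auto simp: vcut_def)
  then show ?thesis using assms by (simp add: blocks_def)
qed

lemma blocksD:
  assumes "K \<in> blocks I J"
  shows "K \<in> Bl2" and "n \<notin> I \<Longrightarrow> K x n = 0" and "x \<in> l2 \<Longrightarrow> K (vcut J x) = K x"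
proof -
  show "K x n = 0" if "n \<notin> I"
  proof -
    have "vcut I (K x) n = K x n" using assms by (simp add: blocks_def)
    then show ?thesis using that by (simp add: vcut_def)
  qed
qed (use assms in \<open>simp_all add: blocks_def\<close>)

lemma blocks_mono:
  assumes K: "K \<in> blocks I J" and "I \<subseteq> I'" "J \<subseteq> J'"
  shows "K \<in> blocks I' J'"
proof (rule blocksI)
  show "K (vcut J' x) = K x" if x: "x \<in> l2" for x
  proof -
    have "K (vcut J' x) = K (vcut J (vcut J' x))" using x by (intro blocksD(3)[OF K, symmetric]) simp
    also have "vcut J (vcut J' x) = vcut J x" using assms by (simp add: vcut_vcut Int_absorb2)
    finally show ?thesis using blocksD(3)[OF K x] by simp
  qed
qed (use assms blocksD[OF K] in auto)

lemma blocks_add: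
  assumes "K \<in> blocks I J" "L \<in> blocks I J"
  shows "op_add K L \<in> blocks I J"
proof (rule blocksI)
  show "op_add K L \<in> Bl2" using assms by (simp add: blocksD(1))
qed (simp_all add: op_add_def blocksD(2,3)[OF assms(1)] blocksD(2,3)[OF assms(2)])

lemma blocks_scale:
  assumes "K \<in> blocks I J"
  shows "op_scale c K \<in> blocks I J"
proof (rule blocksI)
  show "op_scale c K \<in> Bl2" using assms by (simp add: blocksD(1))
qed (simp_all add: op_scale_def blocksD(2,3)[OF assms])

lemma compress_blocks: "T \<in> Bl2 \<Longrightarrow> compress I J T \<in> blocks I J"
proof (rule blocksI)
  show "compress I J T x n = 0" if "n \<notin> I" for x n
    using that by (simp add: compress_def vcut_def)
  show "compress I J T (vcut J x) = compress I J T x" if "x \<in> l2" for x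
    using that by (simp add: compress_def vcut_vcut)
qed simp

text \<open>The values \<open>K x\<close> and \<open>L x\<close> have disjoint supports, so
  Pythagoras computes the norm of their sum.\<close>

lemma opnorm_add_disjoint_rows:
  assumes "K \<in> blocks I U" "L \<in> blocks J V" "I \<inter> J = {}"
  shows "opnorm (op_add K L) \<le> sqrt ((opnorm K)\<^sup>2 + (opnorm L)\<^sup>2)"
proof (rule opnorm_least)
  fix x assume x: "x \<in> l2"
  have B: "K \<in> Bl2" "L \<in> Bl2" using assms by (auto simp: blocks_def)
  let ?y = "op_add K L x"
  have y: "?y \<in> l2" using B by simp
  have K0: "K x n = 0" if "n \<notin> I \<or> n \<in> J" for n
    using blocksD(2)[OF assms(1)] assms(3) that by blast
  have L0: "L x n = 0" if "n \<notin> J \<or> n \<in> I" for n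
    using blocksD(2)[OF assms(2)] assms(3) that by blast
  have "vcut I ?y = K x" "vcut J ?y = L x" "vcut (I \<union> J) ?y = ?y"
    by (auto simp: fun_eq_iff vcut_def op_add_def K0 L0)
  then have "(l2norm ?y)\<^sup>2 = (l2norm (K x))\<^sup>2 + (l2norm (L x))\<^sup>2"
    using l2norm_vcut_split[OF y assms(3)] by simp
  also have "\<dots> \<le> (opnorm K * l2norm x)\<^sup>2 + (opnorm L * l2norm x)\<^sup>2"
    by (intro add_mono power_mono l2norm_apply_le l2norm_nonneg B x Bl2_l2)
  also have "\<dots> = (sqrt ((opnorm K)\<^sup>2 + (opnorm L)\<^sup>2) * l2norm x)\<^sup>2"
    by (simp add: power_mult_distrib algebra_simps)
  finally show "l2norm ?y \<le> sqrt ((opnorm K)\<^sup>2 + (opnorm L)\<^sup>2) * l2norm x"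
    by (rule power2_le_imp_le) (simp add: x l2norm_nonneg)
qed simp

text \<open>The values need not be orthogonal here, but each operator sees only its own part of
  \<open>x\<close>. Cauchy-Schwarz in the plane combines the operator norms with the norms of these
  two orthogonal parts.\<close>

lemma opnorm_add_disjoint_columns:
  assumes "K \<in> blocks U I" "L \<in> blocks V J" "I \<inter> J = {}"
  shows "opnorm (op_add K L) \<le> sqrt ((opnorm K)\<^sup>2 + (opnorm L)\<^sup>2)"
proof (rule opnorm_least)
  fix x assume x: "x \<in> l2"
  have B: "K \<in> Bl2" "L \<in> Bl2" using assms by (auto simp: blocks_def)
  have K: "K (vcut I x) = K x" and L: "L (vcut J x) = L x" using assms x by (auto simp: blocks_def)
  let ?k = "opnorm K" and ?l = "opnorm L" and ?a = "l2norm (vcut I x)" and ?b = "l2norm (vcut J x)"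
  have "l2norm (op_add K L x) \<le> l2norm (K x) + l2norm (L x)"
    using B by (simp add: op_add_def l2norm_add)
  also have "\<dots> \<le> ?k * ?a + ?l * ?b"
    using l2norm_apply_le[OF B(1), of "vcut I x"] l2norm_apply_le[OF B(2), of "vcut J x"] x K L by simp
  also have "\<dots> \<le> sqrt (?k\<^sup>2 + ?l\<^sup>2) * sqrt (?a\<^sup>2 + ?b\<^sup>2)"
  proof -
    \<comment> \<open>By Lagrange's identity the two sides differ by the square of
      \<open>?k * ?b - ?l * ?a\<close>.\<close>
    have "(?k * ?a + ?l * ?b)\<^sup>2 \<le> (?k\<^sup>2 + ?l\<^sup>2) * (?a\<^sup>2 + ?b\<^sup>2)"
      using zero_le_power2[of "?k * ?b - ?l * ?a"] by (simp add: power2_eq_square algebra_simps)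
    then show ?thesis by (simp add: real_le_rsqrt flip: real_sqrt_mult)
  qed
  also have "\<dots> \<le> sqrt (?k\<^sup>2 + ?l\<^sup>2) * l2norm x"
  proof (rule mult_left_mono)
    have "?a\<^sup>2 + ?b\<^sup>2 \<le> (l2norm x)\<^sup>2"
      using l2norm_vcut_split[OF x assms(3)] l2norm_vcut_le[OF x] x by (simp add: l2norm_nonneg power_mono)
    then show "sqrt (?a\<^sup>2 + ?b\<^sup>2) \<le> l2norm x" by (simp add: x l2norm_nonneg real_le_lsqrt)
  qed simp
  finally show "l2norm (op_add K L x) \<le> sqrt (?k\<^sup>2 + ?l\<^sup>2) * l2norm x" .
qed simp

text \<open>The matrix coefficient in row \<open>fst p\<close> and column \<open>snd p\<close>.
  Indexing by pairs lets \<open>entry K\<close> serve directly as the coefficient family of a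
  \<open>lincomb\<close>.\<close>

definition entry :: "op \<Rightarrow> nat \<times> nat \<Rightarrow> complex" where
  "entry T p = T (basis_vec (snd p)) (fst p)"

lemma vcut_lessThan: "vcut {..<M} x = (\<lambda>n. \<Sum>j<M. x j * basis_vec j n)"
  by (auto simp: vcut_def basis_vec_def fun_eq_iff if_distrib cong: if_cong)

text \<open>A finite matrix is the sum of its entries times matrix units, and the vanishing corner
  allows the index \<open>(0, 0)\<close> to be dropped.\<close>

lemma finite_block_eq_lincomb:
  assumes "K \<in> blocks {..<M} {..<M}" "entry K (0, 0) = 0"
  shows "K = lincomb ({..<M} \<times> {..<M} - {(0, 0)}) (entry K)"
proof (intro ext)
  fix x n
  have B: "K \<in> Bl2" using assms by (simp add: blocks_def)
  show "K x n = lincomb ({..<M} \<times> {..<M} - {(0, 0)}) (entry K) x n"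
  proof (cases "x \<in> l2")
    case True
    have "K x = vcut {..<M} (K (vcut {..<M} x))"
      using assms True by (simp add: blocks_def)
    also have "\<dots> = vcut {..<M} (\<lambda>n. \<Sum>j<M. x j * K (basis_vec j) n)"
      unfolding vcut_lessThan[of M x] by (subst Bl2_sum[OF B]) simp_all
    finally have "K x n = (if n < M then \<Sum>j<M. x j * K (basis_vec j) n else 0)"
      by (simp add: vcut_def)
    \<comment> \<open>An artificial sum over rows prepares the double sum over matrix units.\<close>
    also have "\<dots> = (\<Sum>i<M. if i = n then \<Sum>j<M. x j * K (basis_vec j) n else 0)"
      by simp
    also have "\<dots> = (\<Sum>i<M. \<Sum>j<M. entry K (i, j) * E i j x n)"
      using True by (intro sum.cong) (auto simp: entry_def E_def mult.commute)
    also have "\<dots> = (\<Sum>p\<in>{..<M} \<times> {..<M}. entry K p * E (fst p) (snd p) x n)"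
      by (simp add: sum.cartesian_product case_prod_unfold)
    also have "\<dots> = lincomb ({..<M} \<times> {..<M} - {(0, 0)}) (entry K) x n"
      unfolding lincomb_def using assms(2) by (intro sum.mono_neutral_right) auto
    finally show ?thesis .
  qed (simp add: Bl2_outside[OF B] lincomb_def E_def)
qed

lemma finite_block_K0:
  "K \<in> blocks {..<M} {..<M} \<Longrightarrow> entry K (0, 0) = 0 \<Longrightarrow> K \<in> K0"
  by (subst finite_block_eq_lincomb[of K M]) (auto intro!: lincomb_K0)

section \<open>Functionals on the operator system and truncations\<close>

lemma Dual0_combination:
  assumes "f \<in> Dual0" "S \<in> S0" "T \<in> S0"
  shows "f (op_add (op_scale a S) (op_scale b T)) = a * f S + b * f T"
  using assms unfolding Dual0_def by blast

lemma Dual0_add: "f \<in> Dual0 \<Longrightarrow> S \<in> S0 \<Longrightarrow> T \<in> S0 \<Longrightarrow> f (op_add S T) = f S + f T"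
  using Dual0_combination[of f S T 1 1] by simp

lemma Dual0_zero: "f \<in> Dual0 \<Longrightarrow> f op_zero = 0"
  using Dual0_combination[of f idop idop 0 0] idop_S0
  by (simp add: op_add_def op_scale_def op_zero_def)

lemma Dual0_scale: "f \<in> Dual0 \<Longrightarrow> S \<in> S0 \<Longrightarrow> f (op_scale a S) = a * f S"
  using Dual0_combination[of f S S a 0] by (simp add: op_add_def op_scale_def)

lemma Dual0_outside: "f \<in> Dual0 \<Longrightarrow> S \<notin> S0 \<Longrightarrow> f S = 0"
  by (simp add: Dual0_def)

lemma Dual0_bounded:
  assumes "f \<in> Dual0"
  obtains C where "\<And>S. S \<in> S0 \<Longrightarrow> cmod (f S) \<le> C * opnorm S"
  using assms unfolding Dual0_def by blast

lemma E_S0: "p \<noteq> (0, 0) \<Longrightarrow> E (fst p) (snd p) \<in> S0"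
  using lincomb_K0[of "{p}" "\<lambda>_. 1"] by (auto simp: lincomb_def intro: K0_S0)

lemma Dual0_lincomb:
  assumes "f \<in> Dual0"
  shows "finite A \<Longrightarrow> (0, 0) \<notin> A \<Longrightarrow> f (lincomb A c) = (\<Sum>p\<in>A. c p * f (E (fst p) (snd p)))"
proof (induction A rule: finite_induct)
  case (insert p A)
  have "E (fst p) (snd p) \<in> S0" using insert.prems by (intro E_S0) auto
  moreover have "lincomb A c \<in> S0" using insert by (intro K0_S0 lincomb_K0) auto
  ultimately show ?case
    using insert by (simp add: lincomb_insert Dual0_add Dual0_scale S0_scale assms)
qed (simp add: lincomb_empty Dual0_zero assms)

section \<open>The dual norm\<close>

lemma Dual0_norm_le:
  assumes f: "f \<in> Dual0" and S: "S \<in> S0"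
  shows "cmod (f S) \<le> dnorm f * opnorm S"
proof -
  obtain C where C: "\<And>S. S \<in> S0 \<Longrightarrow> cmod (f S) \<le> C * opnorm S"
    using Dual0_bounded[OF f] by blast
  \<comment> \<open>The constant supplied by \<open>Dual0\<close> carries no sign, hence the
    absolute value.\<close>
  have "cmod (f T) \<le> \<bar>C\<bar>" if "T \<in> S0" "opnorm T \<le> 1" for T
  proof -
    have "cmod (f T) \<le> \<bar>C\<bar> * opnorm T"
      using C[OF that(1)] opnorm_nonneg[of T] that(1)
      by (meson S0_Bl2 abs_ge_self mult_right_mono order_trans)
    also have "\<dots> \<le> \<bar>C\<bar>" using that by (simp add: mult_left_le)
    finally show ?thesis .
  qed
  then have bdd: "bdd_above {cmod (f S) | S. S \<in> S0 \<and> opnorm S \<le> 1}"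
    by (auto intro!: bdd_aboveI[of _ "\<bar>C\<bar>"])
  show ?thesis
  proof (cases "opnorm S = 0")
    case True
    then show ?thesis using C[OF S] by simp
  next
    case False
    then have p: "0 < opnorm S" using opnorm_nonneg[of S] S by simp
    let ?c = "complex_of_real (1 / opnorm S)"
    have n: "cmod ?c = 1 / opnorm S" using p by (simp add: norm_divide)
    have "opnorm (op_scale ?c S) = 1"
      unfolding opnorm_scale[OF S0_Bl2[OF S]] n using p by simp
    then have "cmod (f (op_scale ?c S)) \<le> dnorm f"
      unfolding dnorm_def using S S0_scale by (intro cSup_upper bdd) force
    then have "cmod (f S) / opnorm S \<le> dnorm f"
      unfolding Dual0_scale[OF f S] norm_mult n by simp
    then show ?thesis using p by (simp add: divide_le_eq)
  qed
qed

lemma dnorm_least: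
  assumes "\<And>S. S \<in> S0 \<Longrightarrow> cmod (f S) \<le> C * opnorm S" "0 \<le> C"
  shows "dnorm f \<le> C"
  unfolding dnorm_def
proof (rule cSup_least)
  show "{cmod (f S) | S. S \<in> S0 \<and> opnorm S \<le> 1} \<noteq> {}"
    using op_zero_K0 K0_S0 by (auto intro!: exI[of _ op_zero])
  fix r assume "r \<in> {cmod (f S) | S. S \<in> S0 \<and> opnorm S \<le> 1}"
  then show "r \<le> C" using assms mult_left_mono[of _ 1 C] by force
qed

lemma dnorm_nonneg: "f \<in> Dual0 \<Longrightarrow> 0 \<le> dnorm f"
proof -
  assume f: "f \<in> Dual0"
  \<comment> \<open>One element of \<open>S0\<close> with positive norm suffices: dividing the norm
    inequality by that norm shows the sign of \<open>dnorm f\<close>.\<close>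
  have "0 < opnorm (E 1 1)"
  proof -
    have "E 1 1 (basis_vec 1) = basis_vec 1" by (simp add: E_def) (auto simp: basis_vec_def)
    then show ?thesis using opnorm_upper[of "E 1 1" "basis_vec 1"] by simp
  qed
  moreover have "0 \<le> dnorm f * opnorm (E 1 1)"
    using order_trans[OF norm_ge_zero Dual0_norm_le[OF f E_S0[of "(1, 1)"]]] by simp
  ultimately show ?thesis by (simp add: zero_le_mult_iff)
qed

lemma Dual0_linear_combination:
  assumes f: "f \<in> Dual0" and g: "g \<in> Dual0"
  shows "(\<lambda>S. a * f S + b * g S) \<in> Dual0"
proof -
  have "cmod (a * f S + b * g S) \<le> (cmod a * dnorm f + cmod b * dnorm g) * opnorm S" if "S \<in> S0" for S
  proof -
    have "cmod (a * f S + b * g S) \<le> cmod a * cmod (f S) + cmod b * cmod (g S)"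
      by (metis norm_mult norm_triangle_ineq)
    also have "\<dots> \<le> cmod a * (dnorm f * opnorm S) + cmod b * (dnorm g * opnorm S)"
      using that by (intro add_mono mult_left_mono Dual0_norm_le f g) auto
    finally show ?thesis by (simp add: algebra_simps)
  qed
  then have "\<exists>C. \<forall>S\<in>S0. cmod (a * f S + b * g S) \<le> C * opnorm S" by blast
  then show ?thesis
    unfolding Dual0_def
    by (auto simp: Dual0_combination[OF f] Dual0_combination[OF g] Dual0_outside[OF f] Dual0_outside[OF g]
        algebra_simps)
qed

lemma zero_Dual0: "(\<lambda>S. 0) \<in> Dual0"
  by (auto simp: Dual0_def intro: exI[of _ 0])

lemma Dual0_sum:
  "(\<And>i. i \<in> A \<Longrightarrow> f i \<in> Dual0) \<Longrightarrow> (\<lambda>S. \<Sum>i\<in>A. c i * f i S) \<in> Dual0"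
proof (induction A rule: infinite_finite_induct)
  case (insert i A)
  then show ?case
    using Dual0_linear_combination[of "f i" "\<lambda>S. \<Sum>i\<in>A. c i * f i S" "c i" 1] by simp
qed (auto simp: zero_Dual0)

section \<open>Decay of functionals along rows and columns\<close>

text \<open>If a functional still has size about \<open>c\<close> on every tail \<open>\<A> N\<close>, then two
  orthogonal almost norming elements of the tails add up to an element of norm at most
  \<open>sqrt 2\<close> on which it is at least \<open>3/2 c > sqrt 2 c\<close>; hence the bound
  improves by the factor \<open>3/4\<close> further out.\<close>

lemma Dual0_small_on_tails:
  fixes \<A> :: "nat \<Rightarrow> op set"
  assumes f: "f \<in> Dual0"
    and S0: "\<And>N K. K \<in> \<A> N \<Longrightarrow> K \<in> S0"
    and scale: "\<And>N K c. K \<in> \<A> N \<Longrightarrow> op_scale c K \<in> \<A> N"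
    and orth: "\<And>N K. K \<in> \<A> N \<Longrightarrow> \<exists>N'. \<forall>L\<in>\<A> N'. op_add K L \<in> \<A> N \<and>
      opnorm (op_add K L) \<le> sqrt ((opnorm K)\<^sup>2 + (opnorm L)\<^sup>2)"
    and "0 < \<epsilon>"
  shows "\<exists>N. \<forall>K\<in>\<A> N. cmod (f K) \<le> \<epsilon> * opnorm K"
proof -
  define P where "P c \<longleftrightarrow> (\<exists>N. \<forall>K\<in>\<A> N. cmod (f K) \<le> c * opnorm K)" for c
  have step: "P (3 / 4 * c)" if Pc: "P c" and c: "0 < c" for c
  proof (rule ccontr)
    assume not: "\<not> P (3 / 4 * c)"
    have unit: "\<exists>K\<in>\<A> N. opnorm K = 1 \<and> 3 / 4 * c < Re (f K)" for N
    proof -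
      obtain K where K: "K \<in> \<A> N" "3 / 4 * c * opnorm K < cmod (f K)"
        using not by (auto simp: P_def not_le)
      have B: "K \<in> Bl2" "K \<in> S0" using S0[OF K(1)] by auto
      have p: "0 < cmod (f K)"
        using K(2) mult_nonneg_nonneg[of "3 / 4 * c" "opnorm K"] opnorm_nonneg[OF B(1)] c by linarith
      have q: "0 < opnorm K"
        using Dual0_norm_le[OF f B(2)] p opnorm_nonneg[OF B(1)] by (cases "opnorm K = 0") auto
      \<comment> \<open>The scalar turns \<open>f K\<close> onto the positive real axis and
        normalises \<open>K\<close>.\<close>
      define a where "a = cnj (f K) / complex_of_real (cmod (f K) * opnorm K)"
      have a: "cmod a = 1 / opnorm K" using p q by (simp add: a_def norm_divide norm_mult)
      have "a * f K = f K * cnj (f K) / complex_of_real (cmod (f K) * opnorm K)"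
        by (simp add: a_def)
      also have "\<dots> = complex_of_real (cmod (f K) / opnorm K)"
        unfolding complex_norm_square[symmetric] using p q by (simp add: power2_eq_square)
      finally have "f (op_scale a K) = complex_of_real (cmod (f K) / opnorm K)"
        by (simp add: Dual0_scale[OF f B(2)])
      then have "Re (f (op_scale a K)) = cmod (f K) / opnorm K" by simp
      then have "3 / 4 * c < Re (f (op_scale a K))" using K(2) q by (simp add: less_divide_eq)
      moreover have "opnorm (op_scale a K) = 1" unfolding opnorm_scale[OF B(1)] a using q by simp
      ultimately show ?thesis using scale[OF K(1)] by blast
    qed
    obtain N where N: "\<And>K. K \<in> \<A> N \<Longrightarrow> cmod (f K) \<le> c * opnorm K"
      using Pc unfolding P_def by blast
    obtain K where K: "K \<in> \<A> N" "opnorm K = 1" "3 / 4 * c < Re (f K)" using unit by blast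
    obtain N' where N': "\<And>L. L \<in> \<A> N' \<Longrightarrow> op_add K L \<in> \<A> N \<and>
        opnorm (op_add K L) \<le> sqrt ((opnorm K)\<^sup>2 + (opnorm L)\<^sup>2)"
      using orth[OF K(1)] by blast
    obtain L where L: "L \<in> \<A> N'" "opnorm L = 1" "3 / 4 * c < Re (f L)" using unit by blast
    have "opnorm (op_add K L) \<le> sqrt 2" using N'[OF L(1)] K(2) L(2) by simp
    \<comment> \<open>The rational bound \<open>3 / 2\<close> for \<open>sqrt 2\<close> is twice the
      factor \<open>3 / 4\<close>, so the two estimates of \<open>f (op_add K L)\<close> contradict
      each other.\<close>
    also have "\<dots> \<le> 3 / 2" by (rule real_le_lsqrt) (auto simp: power2_eq_square)
    finally have n: "opnorm (op_add K L) \<le> 3 / 2" .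
    have "3 / 2 * c < Re (f (op_add K L))"
      using K L S0 by (simp add: Dual0_add[OF f])
    also have "\<dots> \<le> cmod (f (op_add K L))" by (rule complex_Re_le_cmod)
    also have "\<dots> \<le> c * opnorm (op_add K L)" using N N'[OF L(1)] by blast
    also have "\<dots> \<le> c * (3 / 2)" using n c by (intro mult_left_mono) auto
    finally show False by simp
  qed
  \<comment> \<open>The added 1 makes the starting constant positive even for the zero functional,
    as \<open>step\<close> requires.\<close>
  define C where "C = dnorm f + 1"
  have C: "0 < C" using dnorm_nonneg[OF f] by (simp add: C_def)
  have PC: "P C"
    unfolding P_def
  proof (intro exI ballI)
    fix K assume "K \<in> \<A> 0"
    then have "K \<in> S0" by (rule S0)
    then show "cmod (f K) \<le> C * opnorm K"
      using Dual0_norm_le[OF f, of K] opnorm_nonneg[of K] by (simp add: C_def algebra_simps)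
  qed
  have P: "P ((3 / 4) ^ k * C)" for k
  proof (induction k)
    case (Suc k)
    have "(3 / 4) ^ Suc k * C = 3 / 4 * ((3 / 4) ^ k * C)" by simp
    moreover have "P (3 / 4 * ((3 / 4) ^ k * C))"
      by (rule step[OF Suc.IH]) (use C in auto)
    ultimately show ?case by (simp only:)
  qed (simp add: PC)
  obtain k :: nat where "(3 / 4) ^ k < \<epsilon> / C"
    using real_arch_pow_inv[of "\<epsilon> / C" "3 / 4"] C \<open>0 < \<epsilon>\<close> by auto
  then have k: "(3 / 4) ^ k * C \<le> \<epsilon>" using C by (simp add: less_divide_eq)
  obtain N where N: "\<And>K. K \<in> \<A> N \<Longrightarrow> cmod (f K) \<le> (3 / 4) ^ k * C * opnorm K"
    using P[of k] unfolding P_def by blast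
  have "cmod (f K) \<le> \<epsilon> * opnorm K" if "K \<in> \<A> N" for K
    using N[OF that] mult_right_mono[OF k opnorm_nonneg[OF S0_Bl2[OF S0[OF that]]]] by linarith
  then show ?thesis by blast
qed

text \<open>The tails are finite blocks with rows beyond \<open>N\<close>. Starting at
  \<open>Suc N\<close> leaves out row 0 and with it the corner, so these blocks lie in
  \<open>S0\<close>; each occupies finitely many rows, so a later tail is disjoint from it.\<close>

lemma Dual0_small_on_rows:
  assumes "f \<in> Dual0" "0 < \<epsilon>"
  obtains N where "\<And>K M. K \<in> blocks {Suc N..<M} {..<M} \<Longrightarrow> cmod (f K) \<le> \<epsilon> * opnorm K"
proof -
  define A where "A N = (\<Union>M. blocks {Suc N..<M} {..<M})" for N
  have S0: "K \<in> S0" if "K \<in> A N" for K N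
  proof -
    obtain M where M: "K \<in> blocks {Suc N..<M} {..<M}" using \<open>K \<in> A N\<close> by (auto simp: A_def)
    have "entry K (0, 0) = 0" using blocksD(2)[OF M] by (simp add: entry_def)
    moreover have "K \<in> blocks {..<M} {..<M}" by (rule blocks_mono[OF M]) auto
    ultimately show ?thesis by (intro K0_S0 finite_block_K0)
  qed
  have orth: "\<exists>N'. \<forall>L\<in>A N'. op_add K L \<in> A N \<and>
      opnorm (op_add K L) \<le> sqrt ((opnorm K)\<^sup>2 + (opnorm L)\<^sup>2)" if "K \<in> A N" for K N
  proof -
    obtain M where M: "K \<in> blocks {Suc N..<M} {..<M}" using \<open>K \<in> A N\<close> by (auto simp: A_def)
    \<comment> \<open>From \<open>Suc (N + M)\<close> on, the rows are past those of
      \<open>K\<close> and still inside the tail of index \<open>N\<close>.\<close>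
    show ?thesis
    proof (intro exI[of _ "N + M"] ballI)
      fix L assume "L \<in> A (N + M)"
      then obtain M' where M': "L \<in> blocks {Suc (N + M)..<M'} {..<M'}" by (auto simp: A_def)
      have "op_add K L \<in> blocks {Suc N..<max M M'} {..<max M M'}"
        by (intro blocks_add blocks_mono[OF M] blocks_mono[OF M']) auto
      then show "op_add K L \<in> A N \<and> opnorm (op_add K L) \<le> sqrt ((opnorm K)\<^sup>2 + (opnorm L)\<^sup>2)"
        using opnorm_add_disjoint_rows[OF M M'] by (auto simp: A_def disjoint_iff)
    qed
  qed
  have scale: "op_scale c K \<in> A N" if "K \<in> A N" for N K c
    using that unfolding A_def by (auto intro: blocks_scale)
  have "\<exists>N. \<forall>K\<in>A N. cmod (f K) \<le> \<epsilon> * opnorm K"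
    by (rule Dual0_small_on_tails[of f A]) (fact assms S0 scale orth)+
  then obtain N where "\<forall>K\<in>A N. cmod (f K) \<le> \<epsilon> * opnorm K" by blast
  then show thesis by (intro that[of N]) (auto simp: A_def)
qed

text \<open>Same argument with columns: \<open>Suc N\<close> leaves out column 0, and the
  Cauchy-Schwarz bound for disjoint columns replaces Pythagoras for disjoint rows.\<close>

lemma Dual0_small_on_columns:
  assumes "f \<in> Dual0" "0 < \<epsilon>"
  obtains N where "\<And>K M. K \<in> blocks {..<M} {Suc N..<M} \<Longrightarrow> cmod (f K) \<le> \<epsilon> * opnorm K"
proof -
  define A where "A N = (\<Union>M. blocks {..<M} {Suc N..<M})" for N
  have S0: "K \<in> S0" if "K \<in> A N" for K N
  proof -
    obtain M where M: "K \<in> blocks {..<M} {Suc N..<M}" using \<open>K \<in> A N\<close> by (auto simp: A_def)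
    have "vcut {Suc N..<M} (basis_vec 0) = (\<lambda>n. 0)" by (auto simp: vcut_def basis_vec_def)
    then have "entry K (0, 0) = 0"
      using blocksD(3)[OF M basis_vec_l2[of 0]] Bl2_zero[OF blocksD(1)[OF M]] unfolding entry_def by (metis fst_conv snd_conv)
    moreover have "K \<in> blocks {..<M} {..<M}" by (rule blocks_mono[OF M]) auto
    ultimately show ?thesis by (intro K0_S0 finite_block_K0)
  qed
  have orth: "\<exists>N'. \<forall>L\<in>A N'. op_add K L \<in> A N \<and>
      opnorm (op_add K L) \<le> sqrt ((opnorm K)\<^sup>2 + (opnorm L)\<^sup>2)" if "K \<in> A N" for K N
  proof -
    obtain M where M: "K \<in> blocks {..<M} {Suc N..<M}" using \<open>K \<in> A N\<close> by (auto simp: A_def)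
    show ?thesis
    proof (intro exI[of _ "N + M"] ballI)
      fix L assume "L \<in> A (N + M)"
      then obtain M' where M': "L \<in> blocks {..<M'} {Suc (N + M)..<M'}" by (auto simp: A_def)
      have "op_add K L \<in> blocks {..<max M M'} {Suc N..<max M M'}"
        by (intro blocks_add blocks_mono[OF M] blocks_mono[OF M']) auto
      then show "op_add K L \<in> A N \<and> opnorm (op_add K L) \<le> sqrt ((opnorm K)\<^sup>2 + (opnorm L)\<^sup>2)"
        using opnorm_add_disjoint_columns[OF M M'] by (auto simp: A_def disjoint_iff)
    qed
  qed
  have scale: "op_scale c K \<in> A N" if "K \<in> A N" for N K c
    using that unfolding A_def by (auto intro: blocks_scale)
  have "\<exists>N. \<forall>K\<in>A N. cmod (f K) \<le> \<epsilon> * opnorm K"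
    by (rule Dual0_small_on_tails[of f A]) (fact assms S0 scale orth)+
  then obtain N where "\<forall>K\<in>A N. cmod (f K) \<le> \<epsilon> * opnorm K" by blast
  then show thesis by (intro that[of N]) (auto simp: A_def)
qed

section \<open>Matrix entries and truncations\<close>

lemma entry_op_add [simp]: "entry (op_add S T) p = entry S p + entry T p"
  and entry_op_scale [simp]: "entry (op_scale a T) p = a * entry T p"
  and entry_idop: "entry idop p = (if fst p = snd p then 1 else 0)"
  by (simp_all add: entry_def op_add_def op_scale_def idop_def) (auto simp: basis_vec_def)

lemma cmod_entry_le: "T \<in> Bl2 \<Longrightarrow> cmod (entry T p) \<le> opnorm T"
  using l2norm_component[of "T (basis_vec (snd p))" "fst p"] opnorm_upper[of T "basis_vec (snd p)"]
  by (simp add: entry_def)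

lemma entry_lincomb: "finite A \<Longrightarrow> entry (lincomb A c) p = (if p \<in> A then c p else 0)"
proof -
  assume A: "finite A"
  have "entry (lincomb A c) p = (\<Sum>q\<in>A. if q = p then c q else 0)"
    unfolding entry_def lincomb_def by (intro sum.cong) (auto simp: E_def, auto simp: basis_vec_def prod_eq_iff)
  then show ?thesis using A by simp
qed

text \<open>The shift by a multiple of the identity clears the corner, so that finite compressions
  of the result belong to \<open>K0\<close>.\<close>

definition center :: "op \<Rightarrow> op" where
  "center T = op_add T (op_scale (- entry T (0, 0)) idop)"

text \<open>This is \<open>P\<^sub>N T P\<^sub>N + T\<^sub>0\<^sub>0 (I - P\<^sub>N)\<close>, written as an element of \<open>S\<^sub>0\<close>.\<close>

definition trunc :: "nat \<Rightarrow> op \<Rightarrow> op" where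
  "trunc N T = op_add (op_scale (entry T (0, 0)) idop) (compress {..<N} {..<N} (center T))"

lemma center_Bl2 [simp]: "T \<in> Bl2 \<Longrightarrow> center T \<in> Bl2"
  by (simp add: center_def)

lemma entry_center: "entry (center T) (0, 0) = 0"
  by (simp add: center_def entry_idop)

lemma opnorm_center:
  assumes "T \<in> Bl2"
  shows "opnorm (center T) \<le> 2 * opnorm T"
proof -
  have "opnorm (center T) \<le> opnorm T + cmod (entry T (0, 0)) * opnorm idop"
    using opnorm_add[of T "op_scale (- entry T (0, 0)) idop"] assms
    by (simp add: center_def opnorm_scale)
  also have "\<dots> \<le> opnorm T + opnorm T * 1"
    using assms by (intro add_left_mono mult_mono cmod_entry_le opnorm_idop_le opnorm_nonneg) auto
  finally show ?thesis by simp
qed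

lemma compress_apply: "compress I J T x n = (if x \<in> l2 \<and> n \<in> I then T (vcut J x) n else 0)"
  by (simp add: compress_def vcut_def[of I])

lemma entry_compress: "entry (compress I J T) p = (if fst p \<in> I \<and> snd p \<in> J then entry T p else 0)"
  if "T \<in> Bl2"
proof (cases "snd p \<in> J")
  case True
  then have "vcut J (basis_vec (snd p)) = basis_vec (snd p)" by (auto simp: vcut_def basis_vec_def)
  then show ?thesis using True by (simp add: entry_def compress_def) (simp add: vcut_def)
next
  case False
  then have "vcut J (basis_vec (snd p)) = (\<lambda>n. 0)" by (auto simp: vcut_def basis_vec_def)
  then show ?thesis using False by (simp add: entry_def compress_def Bl2_zero[OF that])
qed

lemma compress_center_K0: "T \<in> Bl2 \<Longrightarrow> compress {..<N} {..<N} (center T) \<in> K0"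
  by (rule finite_block_K0[of _ N]) (simp_all add: compress_blocks entry_compress entry_center)

lemma trunc_S0 [simp]: "T \<in> Bl2 \<Longrightarrow> trunc N T \<in> S0"
  by (simp add: trunc_def S0I compress_center_K0)

text \<open>The scalar part contributes \<open>opnorm T\<close> and the centered part twice that.
  What matters later is that the factor does not depend on \<open>N\<close>.\<close>

lemma opnorm_trunc:
  assumes "T \<in> Bl2"
  shows "opnorm (trunc N T) \<le> 3 * opnorm T"
proof -
  have "opnorm (trunc N T) \<le> cmod (entry T (0, 0)) * opnorm idop + opnorm (compress {..<N} {..<N} (center T))"
    using opnorm_add[of "op_scale (entry T (0, 0)) idop" "compress {..<N} {..<N} (center T)"] assms
    by (simp add: trunc_def opnorm_scale)
  also have "\<dots> \<le> opnorm T * 1 + 2 * opnorm T"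
    using assms opnorm_compress[of "center T"] opnorm_center[OF assms]
    by (intro add_mono mult_mono cmod_entry_le opnorm_idop_le opnorm_nonneg) (auto intro: order_trans)
  finally show ?thesis by simp
qed

lemma trunc_lincomb:
  "trunc N (op_add (op_scale a S) (op_scale b T)) = op_add (op_scale a (trunc N S)) (op_scale b (trunc N T))"
  by (auto simp: fun_eq_iff trunc_def center_def compress_def vcut_def op_add_def op_scale_def entry_def algebra_simps)

lemma trunc_add: "trunc N (op_add S T) = op_add (trunc N S) (trunc N T)"
  using trunc_lincomb[of N 1 S 1 T] by simp

lemma trunc_idop: "trunc N idop = idop"
proof -
  have "center idop = op_zero"
    by (simp add: center_def entry_idop) (simp add: op_add_def op_scale_def op_zero_def)
  then show ?thesis
    by (simp add: trunc_def entry_idop) (auto simp: fun_eq_iff compress_def op_zero_def vcut_def op_add_def)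
qed

lemma trunc_scale: "trunc N (op_scale a T) = op_scale a (trunc N T)"
  using trunc_lincomb[of N a T 0 T] by (simp add: op_add_def op_scale_def)

lemma trunc_finite_block:
  assumes K: "K \<in> blocks {..<N} {..<N}" "entry K (0, 0) = 0"
  shows "trunc N K = K"
proof (intro ext)
  fix x n
  show "trunc N K x n = K x n"
    using blocksD(2)[OF K(1), of n x] blocksD(3)[OF K(1), of x] Bl2_outside[OF blocksD(1)[OF K(1)], of x] K(2)
    by (cases "x \<in> l2")
      (auto simp: trunc_def center_def compress_def vcut_def op_add_def op_scale_def)
qed

lemma lincomb_blocks:
  assumes A: "A \<subseteq> {..<N} \<times> {..<N}"
  shows "lincomb A c \<in> blocks {..<N} {..<N}"
proof (rule blocksI)
  show "lincomb A c \<in> Bl2" using finite_subset[OF A] by simp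
  show "lincomb A c x n = 0" if "n \<notin> {..<N}" for x n
    unfolding lincomb_def using that A by (intro sum.neutral) (auto simp: E_def)
  show "lincomb A c (vcut {..<N} x) = lincomb A c x" if "x \<in> l2" for x
  proof (intro ext)
    fix n
    have "vcut {..<N} x (snd p) = x (snd p)" if "p \<in> A" for p
      using A that by (auto simp: vcut_def)
    then show "lincomb A c (vcut {..<N} x) n = lincomb A c x n"
      unfolding lincomb_def using that by (intro sum.cong) (simp_all add: E_def)
  qed
qed

text \<open>Truncations fix \<open>idop\<close> and eventually fix each finite matrix with zero
  corner; their uniform boundedness carries the convergence over to the norm closure.\<close>

lemma trunc_S0_tendsto:
  assumes f: "f \<in> Dual0" and S: "S \<in> S0"
  shows "(\<lambda>N. f (trunc N S)) \<longlonglongrightarrow> f S"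
proof (rule LIMSEQ_I)
  fix \<epsilon> :: real assume e: "0 < \<epsilon>"
  \<comment> \<open>The error is at most \<open>dnorm f\<close> times the norms of \<open>D\<close>
    and of its truncation, together \<open>4 * opnorm D\<close>. The added 1 keeps the quotient
    defined and the final estimate strict.\<close>
  define \<delta> where "\<delta> = \<epsilon> / (4 * (dnorm f + 1))"
  have d: "0 < \<delta>" using e dnorm_nonneg[OF f] by (simp add: \<delta>_def)
  obtain c K where SK: "S = op_add (op_scale c idop) K" "K \<in> K0" using S by (rule S0E)
  obtain A a where A: "finite A" "(0, 0) \<notin> A" and D: "opnorm (op_add K (op_scale (-1) (lincomb A a))) < \<delta>"
    using K0_approx[OF SK(2) d] by blast
  define L where "L = lincomb A a"
  define D where "D = op_add K (op_scale (-1) L)"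
  have L0: "L \<in> S0" and D0: "D \<in> S0"
    using SK(2) lincomb_K0[OF A] by (auto simp: L_def D_def intro!: K0_S0 K0_add K0_scale)
  have Seq: "S = op_add (op_add (op_scale c idop) L) D"
    by (simp add: SK D_def op_add_def op_scale_def)
  have cI: "op_scale c idop \<in> S0" by (simp add: S0_scale idop_S0)
  obtain N0 where N0: "A \<subseteq> {..<N0} \<times> {..<N0}"
  proof -
    obtain k where "\<forall>n\<in>fst ` A \<union> snd ` A. n < k"
      using finite_nat_set_iff_bounded[of "fst ` A \<union> snd ` A"] A(1) by auto
    then have "A \<subseteq> {..<k} \<times> {..<k}" by force
    then show thesis by (rule that)
  qed
  have "cmod (f (trunc N S) - f S) < \<epsilon>" if N: "N0 \<le> N" for N
  proof -
    have "A \<subseteq> {..<N} \<times> {..<N}" using N0 N by auto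
    then have "trunc N L = L"
      unfolding L_def using A by (intro trunc_finite_block lincomb_blocks) (simp_all add: entry_lincomb)
    then have "f (trunc N S) - f S = f (trunc N D) - f D"
      unfolding Seq trunc_add trunc_scale trunc_idop
      using L0 D0 cI by (simp add: Dual0_add[OF f] S0_add)
    also have "cmod \<dots> \<le> cmod (f (trunc N D)) + cmod (f D)" by (rule norm_triangle_ineq4)
    also have "\<dots> \<le> dnorm f * opnorm (trunc N D) + dnorm f * opnorm D"
      using D0 by (intro add_mono Dual0_norm_le f) auto
    also have "\<dots> \<le> dnorm f * (3 * opnorm D) + dnorm f * opnorm D"
      using D0 by (intro add_mono mult_left_mono opnorm_trunc dnorm_nonneg f) auto
    also have "\<dots> = (4 * dnorm f) * opnorm D" by simp
    also have "\<dots> \<le> (4 * dnorm f) * \<delta>"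
      using D dnorm_nonneg[OF f] by (intro mult_left_mono) (auto simp: D_def L_def)
    also have "\<dots> < (4 * (dnorm f + 1)) * \<delta>" using d by simp
    also have "\<dots> = \<epsilon>" using dnorm_nonneg[OF f] by (simp add: \<delta>_def)
    finally show ?thesis .
  qed
  then show "\<exists>N0. \<forall>N\<ge>N0. cmod (f (trunc N S) - f S) < \<epsilon>" by blast
qed

text \<open>Two truncations differ by a block in far rows and a block in far columns of the centered
  operator, where \<open>f\<close> is small relative to the norm. Hence one \<open>N\<close> serves
  every \<open>T\<close>.\<close>

lemma trunc_uniformly_Cauchy:
  assumes f: "f \<in> Dual0" and e: "0 < \<epsilon>"
  obtains N where "\<And>M T. N \<le> M \<Longrightarrow> T \<in> Bl2 \<Longrightarrow> cmod (f (trunc M T) - f (trunc N T)) \<le> \<epsilon> * opnorm T"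
proof -
  \<comment> \<open>A quarter of \<open>\<epsilon>\<close> is right because there are two blocks,
    each of norm at most \<open>2 * opnorm T\<close>.\<close>
  obtain N1 where N1: "\<And>K M. K \<in> blocks {Suc N1..<M} {..<M} \<Longrightarrow> cmod (f K) \<le> \<epsilon> / 4 * opnorm K"
    using Dual0_small_on_rows[OF f, of "\<epsilon> / 4"] e by auto
  obtain N2 where N2: "\<And>K M. K \<in> blocks {..<M} {Suc N2..<M} \<Longrightarrow> cmod (f K) \<le> \<epsilon> / 4 * opnorm K"
    using Dual0_small_on_columns[OF f, of "\<epsilon> / 4"] e by auto
  \<comment> \<open>The successor matches the starting indices \<open>Suc N1\<close> and
    \<open>Suc N2\<close> and makes \<open>N\<close> positive, so the corner lies in neither
    block.\<close>
  define N where "N = Suc (max N1 N2)"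
  have "cmod (f (trunc M T) - f (trunc N T)) \<le> \<epsilon> * opnorm T" if M: "N \<le> M" and T: "T \<in> Bl2" for M T
  proof -
    let ?C = "center T"
    \<comment> \<open>The square of size \<open>M\<close> without the square of size
      \<open>N\<close> is cut into all new rows, and the new columns within the old rows.\<close>
    define K where "K = compress {N..<M} {..<M} ?C"
    define L where "L = compress {..<N} {N..<M} ?C"
    have C: "?C \<in> Bl2" using T by simp
    have "?C (vcut {..<M} x) = (\<lambda>n. ?C (vcut {..<N} x) n + ?C (vcut {N..<M} x) n)" if "x \<in> l2" for x
    proof -
      have "vcut {..<M} x = (\<lambda>n. 1 * vcut {..<N} x n + 1 * vcut {N..<M} x n)"
        using M by (auto simp: vcut_def fun_eq_iff)
      then show ?thesis using Bl2_lincomb[OF C, of "vcut {..<N} x" "vcut {N..<M} x" 1 1] that by simp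
    qed
    then have eq: "trunc M T = op_add (trunc N T) (op_add K L)"
      using M by (auto simp: fun_eq_iff trunc_def K_def L_def compress_apply op_add_def)
    have bK: "cmod (f K) \<le> \<epsilon> / 4 * opnorm K"
      unfolding K_def by (rule N1[of _ M], rule blocks_mono[OF compress_blocks[OF C]]) (auto simp: N_def)
    have bL: "cmod (f L) \<le> \<epsilon> / 4 * opnorm L"
      unfolding L_def by (rule N2[of _ M], rule blocks_mono[OF compress_blocks[OF C]]) (use M in \<open>auto simp: N_def\<close>)
    have "entry K (0, 0) = 0" "entry L (0, 0) = 0"
      by (simp_all add: K_def L_def entry_compress[OF C] N_def)
    moreover have "K \<in> blocks {..<M} {..<M}" "L \<in> blocks {..<M} {..<M}"
      unfolding K_def L_def by (rule blocks_mono[OF compress_blocks[OF C]]; use M in force)+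
    ultimately have S: "K \<in> S0" "L \<in> S0" by (auto intro: K0_S0 finite_block_K0)
    have n: "opnorm K \<le> 2 * opnorm T" "opnorm L \<le> 2 * opnorm T"
      using opnorm_compress[OF C] opnorm_center[OF T] by (auto simp: K_def L_def intro: order_trans)
    have "f (trunc M T) - f (trunc N T) = f K + f L"
      unfolding eq using S T by (simp add: Dual0_add[OF f] S0_add)
    also have "cmod \<dots> \<le> cmod (f K) + cmod (f L)" by (rule norm_triangle_ineq)
    also have "\<dots> \<le> \<epsilon> / 4 * (2 * opnorm T) + \<epsilon> / 4 * (2 * opnorm T)"
      using bK bL e mult_left_mono[OF n(1), of "\<epsilon> / 4"] mult_left_mono[OF n(2), of "\<epsilon> / 4"] by linarith
    finally show ?thesis by simp
  qed
  then show thesis by (rule that)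
qed

section \<open>The bidual\<close>

text \<open>The value 0 outside \<open>S0\<close> follows the convention of \<open>Dual0\<close>.
  For basis vectors these are the coordinate functionals.\<close>

definition vec_functional :: "vec \<Rightarrow> vec \<Rightarrow> op \<Rightarrow> complex" where
  "vec_functional x y S = (if S \<in> S0 then inner_l2 (S x) y else 0)"

lemma vec_functional_le:
  assumes "x \<in> l2" "y \<in> l2" "S \<in> S0"
  shows "cmod (vec_functional x y S) \<le> (l2norm x * l2norm y) * opnorm S"
proof -
  have "cmod (vec_functional x y S) \<le> l2norm (S x) * l2norm y"
    using assms by (simp add: vec_functional_def inner_l2_Cauchy_Schwarz)
  also have "\<dots> \<le> (opnorm S * l2norm x) * l2norm y"
    using assms by (intro mult_right_mono l2norm_apply_le l2norm_nonneg) auto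
  finally show ?thesis by (simp add: mult_ac)
qed

lemma vec_functional_Dual0:
  assumes "x \<in> l2" "y \<in> l2"
  shows "vec_functional x y \<in> Dual0"
proof -
  have "\<exists>C. \<forall>S\<in>S0. cmod (vec_functional x y S) \<le> C * opnorm S"
    using vec_functional_le[OF assms] by blast
  moreover have "vec_functional x y (op_add (op_scale a S) (op_scale b T)) =
      a * vec_functional x y S + b * vec_functional x y T" if "S \<in> S0" "T \<in> S0" for S T a b
    using inner_l2_lincomb_left[of "S x" "T x" y a b] that assms
    by (simp add: vec_functional_def S0_add S0_scale) (simp add: op_add_def op_scale_def)
  ultimately show ?thesis
    by (simp add: Dual0_def) (simp add: vec_functional_def)
qed

lemma dnorm_vec_functional_le: "x \<in> l2 \<Longrightarrow> y \<in> l2 \<Longrightarrow> dnorm (vec_functional x y) \<le> l2norm x * l2norm y"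
  by (intro dnorm_least vec_functional_le mult_nonneg_nonneg l2norm_nonneg)

lemma vec_functional_basis_vec: "S \<in> S0 \<Longrightarrow> vec_functional (basis_vec j) (basis_vec i) S = entry S (i, j)"
  by (simp add: vec_functional_def inner_l2_basis_vec entry_def)

lemma inner_l2_split:
  assumes "x \<in> l2" "y \<in> l2"
  shows "inner_l2 x y = inner_l2 (vcut {..<N} x) (vcut {..<N} y) + inner_l2 (vcut {N..} x) (vcut {N..} y)"
proof -
  have "x = (\<lambda>n. 1 * vcut {..<N} x n + 1 * vcut {N..} x n)" by (auto simp: vcut_def)
  then have "inner_l2 x y = 1 * inner_l2 (vcut {..<N} x) y + 1 * inner_l2 (vcut {N..} x) y"
    using inner_l2_lincomb_left[of "vcut {..<N} x" "vcut {N..} x" y 1 1] assms by simp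
  moreover have "inner_l2 (vcut I x) y = inner_l2 (vcut I x) (vcut I y)" for I
    using inner_l2_vcut[of I "vcut I x" y] by (simp add: vcut_vcut)
  ultimately show ?thesis by simp
qed

text \<open>Centering cancels on the first \<open>N\<close> coordinates, leaving \<open>T\<close>
  there and the scalar corner entry on the tail. Weak convergence and preservation of positivity are
  both read off from this form.\<close>

lemma inner_l2_trunc:
  assumes T: "T \<in> Bl2" and "x \<in> l2" "y \<in> l2"
  shows "inner_l2 (trunc N T x) y = inner_l2 (T (vcut {..<N} x)) (vcut {..<N} y) +
    entry T (0, 0) * inner_l2 (vcut {N..} x) (vcut {N..} y)"
proof -
  let ?c = "entry T (0, 0)" and ?P = "vcut {..<N}"
  have C: "center T (?P x) = (\<lambda>n. 1 * T (?P x) n + (- ?c) * ?P x n)"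
    using assms by (auto simp: center_def op_add_def op_scale_def idop_def)
  have "trunc N T x = (\<lambda>n. ?c * x n + 1 * ?P (center T (?P x)) n)"
    using assms by (auto simp: trunc_def op_add_def op_scale_def idop_def compress_def)
  then have "inner_l2 (trunc N T x) y = ?c * inner_l2 x y + 1 * inner_l2 (?P (center T (?P x))) y"
    using inner_l2_lincomb_left[of x "?P (center T (?P x))" y ?c 1] assms by simp
  also have "inner_l2 (?P (center T (?P x))) y = inner_l2 (center T (?P x)) (?P y)"
    by (rule inner_l2_vcut)
  also have "\<dots> = 1 * inner_l2 (T (?P x)) (?P y) + (- ?c) * inner_l2 (?P x) (?P y)"
    unfolding C using assms by (intro inner_l2_lincomb_left) auto
  finally show ?thesis
    using inner_l2_split[OF assms(2,3), of N] by (simp add: algebra_simps)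
qed

lemma LIMSEQ_null_bound: "(\<And>n. norm (f n) \<le> g n) \<Longrightarrow> g \<longlonglongrightarrow> 0 \<Longrightarrow> f \<longlonglongrightarrow> 0"
  by (rule tendsto_0_le[of g _ f 1]) (auto intro!: always_eventually order_trans[OF _ abs_ge_self])

text \<open>Every error term contains a tail of \<open>x\<close> or \<open>y\<close>, whose norm
  tends to 0, while the other factors stay bounded.\<close>

lemma inner_l2_trunc_tendsto:
  assumes T: "T \<in> Bl2" and x: "x \<in> l2" and y: "y \<in> l2"
  shows "(\<lambda>N. inner_l2 (trunc N T x) y) \<longlonglongrightarrow> inner_l2 (T x) y"
proof -
  let ?P = "\<lambda>N. vcut {..<N}" and ?Q = "\<lambda>N. vcut {N..}"
  let ?c = "entry T (0, 0)"
  have split: "z = (\<lambda>n. 1 * ?P N z n + 1 * ?Q N z n)" for z N by (auto simp: vcut_def)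
  have eq: "inner_l2 (trunc N T x) y - inner_l2 (T x) y =
      ?c * inner_l2 (?Q N x) (?Q N y) - (inner_l2 (T (?Q N x)) (?P N y) + inner_l2 (T x) (?Q N y))" for N
  proof -
    have "T x = (\<lambda>n. 1 * T (?P N x) n + 1 * T (?Q N x) n)"
      using Bl2_lincomb[OF T, of "?P N x" "?Q N x" 1 1] x split[of x N] by simp
    then have "inner_l2 (T x) (?P N y) = inner_l2 (T (?P N x)) (?P N y) + inner_l2 (T (?Q N x)) (?P N y)"
      using inner_l2_lincomb_left[of "T (?P N x)" "T (?Q N x)" "?P N y" 1 1] T y by simp
    moreover have "inner_l2 (T x) y = inner_l2 (T x) (?P N y) + inner_l2 (T x) (?Q N y)"
      using inner_l2_lincomb_right[of "T x" "?P N y" "?Q N y" 1 1] split[of y N] T y by simp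
    ultimately show ?thesis by (simp add: inner_l2_trunc[OF T x y])
  qed
  have tail: "(\<lambda>N. l2norm (?Q N z)) \<longlonglongrightarrow> 0" if "z \<in> l2" for z
    by (rule l2norm_vcut_tail_tendsto[OF that])
  have "(\<lambda>N. inner_l2 (?Q N x) (?Q N y)) \<longlonglongrightarrow> 0"
    by (rule LIMSEQ_null_bound[OF _ tendsto_mult_zero[OF tail[OF x] tail[OF y]]])
      (simp add: inner_l2_Cauchy_Schwarz x y)
  moreover have "(\<lambda>N. inner_l2 (T (?Q N x)) (?P N y)) \<longlonglongrightarrow> 0"
  proof (rule LIMSEQ_null_bound)
    show "cmod (inner_l2 (T (?Q N x)) (?P N y)) \<le> l2norm (?Q N x) * (opnorm T * l2norm y)" for N
    proof -
      have "cmod (inner_l2 (T (?Q N x)) (?P N y)) \<le> l2norm (T (?Q N x)) * l2norm (?P N y)"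
        using T y by (simp add: inner_l2_Cauchy_Schwarz)
      also have "\<dots> \<le> (opnorm T * l2norm (?Q N x)) * l2norm y"
        using T x y by (intro mult_mono l2norm_apply_le l2norm_vcut_le mult_nonneg_nonneg opnorm_nonneg l2norm_nonneg) auto
      finally show ?thesis by (simp add: mult_ac)
    qed
    show "(\<lambda>N. l2norm (?Q N x) * (opnorm T * l2norm y)) \<longlonglongrightarrow> 0"
      by (rule tendsto_mult_left_zero[OF tail[OF x]])
  qed
  moreover have "(\<lambda>N. inner_l2 (T x) (?Q N y)) \<longlonglongrightarrow> 0"
    by (rule LIMSEQ_null_bound[OF _ tendsto_mult_right_zero[OF tail[OF y], of "l2norm (T x)"]])
      (simp add: inner_l2_Cauchy_Schwarz T y)
  ultimately have "(\<lambda>N. inner_l2 (trunc N T x) y - inner_l2 (T x) y) \<longlonglongrightarrow> ?c * 0 - (0 + 0)"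
    unfolding eq by (intro tendsto_intros)
  then show ?thesis by (simp add: LIM_zero_iff)
qed

definition bidual_of :: "op \<Rightarrow> (op \<Rightarrow> complex) \<Rightarrow> complex" where
  "bidual_of T f = (if f \<in> Dual0 then lim (\<lambda>N. f (trunc N T)) else 0)"

text \<open>The uniform Cauchy estimate for a single \<open>T\<close> and completeness of the
  complex numbers show that the \<open>lim\<close> in \<open>bidual_of\<close> is a genuine
  limit.\<close>

lemma bidual_of_tendsto:
  assumes T: "T \<in> Bl2" and f: "f \<in> Dual0"
  shows "(\<lambda>N. f (trunc N T)) \<longlonglongrightarrow> bidual_of T f"
proof -
  have "Cauchy (\<lambda>N. f (trunc N T))"
  proof (rule metric_CauchyI)
    fix \<epsilon> :: real assume e: "0 < \<epsilon>"
    \<comment> \<open>This puts \<open>\<delta> * opnorm T\<close> strictly below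
      \<open>\<epsilon> / 2\<close>, as needed to compare two truncations through
      \<open>trunc N T\<close>.\<close>
    define \<delta> where "\<delta> = \<epsilon> / (4 * (opnorm T + 1))"
    have p: "0 < opnorm T + 1" using opnorm_nonneg[OF T] by simp
    then have d: "0 < \<delta>" using e by (simp add: \<delta>_def)
    obtain N where N: "\<And>M T. N \<le> M \<Longrightarrow> T \<in> Bl2 \<Longrightarrow> cmod (f (trunc M T) - f (trunc N T)) \<le> \<delta> * opnorm T"
      using trunc_uniformly_Cauchy[OF f d] by blast
    have "\<delta> * opnorm T \<le> \<delta> * (opnorm T + 1)" using d by simp
    also have "\<dots> = \<epsilon> / 4" unfolding \<delta>_def using p by (simp add: field_simps)
    finally have "cmod (f (trunc M T) - f (trunc N T)) < \<epsilon> / 2" if "N \<le> M" for M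
      using N[OF that T] e by linarith
    then have "dist (f (trunc M T)) (f (trunc N T)) < \<epsilon> / 2" if "N \<le> M" for M
      using that by (simp add: dist_norm)
    then show "\<exists>M. \<forall>m\<ge>M. \<forall>n\<ge>M. dist (f (trunc m T)) (f (trunc n T)) < \<epsilon>"
      by (meson dist_triangle_half_l)
  qed
  then show ?thesis
    using f by (simp add: bidual_of_def Cauchy_convergent_iff convergent_LIMSEQ_iff)
qed

text \<open>The larger index goes to infinity in the uniform Cauchy estimate. Restricted to
  \<open>S0\<close> this says that composing \<open>f\<close> with \<open>trunc N\<close>
  approximates \<open>f\<close> in the dual norm.\<close>

lemma bidual_of_uniform_approx:
  assumes f: "f \<in> Dual0" and e: "0 < \<epsilon>"
  obtains N where "\<And>T. T \<in> Bl2 \<Longrightarrow> cmod (bidual_of T f - f (trunc N T)) \<le> \<epsilon> * opnorm T"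
proof -
  obtain N where N: "\<And>M T. N \<le> M \<Longrightarrow> T \<in> Bl2 \<Longrightarrow> cmod (f (trunc M T) - f (trunc N T)) \<le> \<epsilon> * opnorm T"
    using trunc_uniformly_Cauchy[OF f e] by blast
  have "cmod (bidual_of T f - f (trunc N T)) \<le> \<epsilon> * opnorm T" if T: "T \<in> Bl2" for T
  proof (rule Lim_bounded)
    show "(\<lambda>M. cmod (f (trunc M T) - f (trunc N T))) \<longlonglongrightarrow> cmod (bidual_of T f - f (trunc N T))"
      by (intro tendsto_intros bidual_of_tendsto T f)
    show "\<forall>M\<ge>N. cmod (f (trunc M T) - f (trunc N T)) \<le> \<epsilon> * opnorm T"
      using N T by blast
  qed
  then show thesis by (rule that)
qed

text \<open>Both sides are limits of \<open>f (trunc N S)\<close>. Thus \<open>bidual_of\<close>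
  extends the canonical embedding of \<open>S0\<close> into its bidual.\<close>

lemma bidual_of_S0: "S \<in> S0 \<Longrightarrow> f \<in> Dual0 \<Longrightarrow> bidual_of S f = f S"
  by (rule LIMSEQ_unique[OF bidual_of_tendsto trunc_S0_tendsto]) auto

text \<open>Linearity and boundedness in \<open>f\<close> pass to the limit, the latter because
  truncations are bounded uniformly in \<open>N\<close>.\<close>

lemma bidual_of_Bidual0:
  assumes T: "T \<in> Bl2"
  shows "bidual_of T \<in> Bidual0"
proof -
  have "bidual_of T (\<lambda>S. a * f S + b * g S) = a * bidual_of T f + b * bidual_of T g"
    if f: "f \<in> Dual0" and g: "g \<in> Dual0" for f g a b
  proof (rule LIMSEQ_unique)
    show "(\<lambda>N. a * f (trunc N T) + b * g (trunc N T)) \<longlonglongrightarrow> bidual_of T (\<lambda>S. a * f S + b * g S)"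
      using bidual_of_tendsto[OF T Dual0_linear_combination[OF f g]] .
    show "(\<lambda>N. a * f (trunc N T) + b * g (trunc N T)) \<longlonglongrightarrow> a * bidual_of T f + b * bidual_of T g"
      by (intro tendsto_intros bidual_of_tendsto T f g)
  qed
  moreover have "cmod (bidual_of T f) \<le> (3 * opnorm T) * dnorm f" if f: "f \<in> Dual0" for f
  proof (rule Lim_bounded)
    show "(\<lambda>N. cmod (f (trunc N T))) \<longlonglongrightarrow> cmod (bidual_of T f)"
      by (intro tendsto_intros bidual_of_tendsto T f)
    have "cmod (f (trunc N T)) \<le> (3 * opnorm T) * dnorm f" for N
      using Dual0_norm_le[OF f trunc_S0[OF T, of N]]
        mult_left_mono[OF opnorm_trunc[OF T, of N] dnorm_nonneg[OF f]] by (simp add: mult_ac)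
    then show "\<forall>N\<ge>0. cmod (f (trunc N T)) \<le> (3 * opnorm T) * dnorm f" by blast
  qed
  then have "\<exists>C. \<forall>f\<in>Dual0. cmod (bidual_of T f) \<le> C * dnorm f" by blast
  ultimately show ?thesis
    by (simp add: Bidual0_def) (simp add: bidual_of_def)
qed

lemma bidual_of_lincomb:
  assumes S: "S \<in> Bl2" and T: "T \<in> Bl2"
  shows "bidual_of (op_add (op_scale a S) (op_scale b T)) = (\<lambda>f. a * bidual_of S f + b * bidual_of T f)"
proof
  fix f
  show "bidual_of (op_add (op_scale a S) (op_scale b T)) f = a * bidual_of S f + b * bidual_of T f"
  proof (cases "f \<in> Dual0")
    case True
    have "(\<lambda>N. f (trunc N (op_add (op_scale a S) (op_scale b T)))) \<longlonglongrightarrow> a * bidual_of S f + b * bidual_of T f"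
      unfolding trunc_lincomb using S T
      by (simp add: Dual0_combination[OF True]) (intro tendsto_intros bidual_of_tendsto S T True)
    then show ?thesis
      using S T by (intro LIMSEQ_unique[OF bidual_of_tendsto[OF _ True]]) auto
  qed (simp add: bidual_of_def)
qed

text \<open>Weak convergence of the truncations identifies the limit. These values determine
  \<open>T\<close>, which gives injectivity, and they let positivity of \<open>T\<close> be tested
  in the bidual.\<close>

lemma bidual_of_vec_functional:
  assumes "T \<in> Bl2" "x \<in> l2" "y \<in> l2"
  shows "bidual_of T (vec_functional x y) = inner_l2 (T x) y"
proof (rule LIMSEQ_unique)
  show "(\<lambda>N. vec_functional x y (trunc N T)) \<longlonglongrightarrow> bidual_of T (vec_functional x y)"
    using assms by (intro bidual_of_tendsto vec_functional_Dual0)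
  show "(\<lambda>N. vec_functional x y (trunc N T)) \<longlonglongrightarrow> inner_l2 (T x) y"
    using inner_l2_trunc_tendsto[OF assms] assms by (simp add: vec_functional_def)
qed

lemma inj_on_bidual_of: "inj_on bidual_of Bl2"
proof (rule inj_onI)
  fix S T assume S: "S \<in> Bl2" and T: "T \<in> Bl2" and eq: "bidual_of S = bidual_of T"
  show "S = T"
  proof (intro ext)
    fix x n
    show "S x n = T x n"
    proof (cases "x \<in> l2")
      case True
      have "S x n = bidual_of S (vec_functional x (basis_vec n))"
        by (simp add: bidual_of_vec_functional S True inner_l2_basis_vec)
      also have "\<dots> = T x n"
        unfolding eq by (simp add: bidual_of_vec_functional T True inner_l2_basis_vec)
      finally show ?thesis .
    qed (simp add: Bl2_outside[OF S] Bl2_outside[OF T])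
  qed
qed

section \<open>Surjectivity onto the bidual\<close>

lemma Bidual0_combination:
  "F \<in> Bidual0 \<Longrightarrow> f \<in> Dual0 \<Longrightarrow> g \<in> Dual0 \<Longrightarrow> F (\<lambda>S. a * f S + b * g S) = a * F f + b * F g"
  unfolding Bidual0_def by blast

lemma Bidual0_sum:
  assumes F: "F \<in> Bidual0"
  shows "(\<And>i. i \<in> A \<Longrightarrow> f i \<in> Dual0) \<Longrightarrow> F (\<lambda>S. \<Sum>i\<in>A. c i * f i S) = (\<Sum>i\<in>A. c i * F (f i))"
proof (induction A rule: infinite_finite_induct)
  case (insert i A)
  then show ?case
    using Bidual0_combination[OF F, of "f i" "\<lambda>S. \<Sum>i\<in>A. c i * f i S" "c i" 1] by (simp add: Dual0_sum)
qed (use Bidual0_combination[OF F zero_Dual0 zero_Dual0, of 0 0] in simp_all)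

lemma Bidual0_bounded:
  assumes "F \<in> Bidual0"
  obtains C where "0 \<le> C" "\<And>f. f \<in> Dual0 \<Longrightarrow> cmod (F f) \<le> C * dnorm f"
proof -
  obtain C where C: "\<And>f. f \<in> Dual0 \<Longrightarrow> cmod (F f) \<le> C * dnorm f"
    using assms unfolding Bidual0_def by blast
  have "cmod (F f) \<le> \<bar>C\<bar> * dnorm f" if "f \<in> Dual0" for f
    using C[OF that] mult_right_mono[OF abs_ge_self[of C] dnorm_nonneg[OF that]] by linarith
  then show thesis by (intro that[of "\<bar>C\<bar>"]) auto
qed

lemma l2norm_vcut_lessThan: "l2norm (vcut {..<N} z) = L2_set (\<lambda>n. cmod (z n)) {..<N}"
  unfolding l2norm_def L2_set_def by (subst suminf_finite[of "{..<N}"]) (auto simp: vcut_def)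

text \<open>The candidate preimage of \<open>F\<close>: by \<open>bidual_of_vec_functional\<close>
  an operator representing \<open>F\<close> must have these coordinates.\<close>

definition op_of :: "((op \<Rightarrow> complex) \<Rightarrow> complex) \<Rightarrow> op" where
  "op_of F = (\<lambda>x n. if x \<in> l2 then F (vec_functional x (basis_vec n)) else 0)"

lemma vec_functional_lincomb_left:
  "x \<in> l2 \<Longrightarrow> x' \<in> l2 \<Longrightarrow> y \<in> l2 \<Longrightarrow>
    vec_functional (\<lambda>n. a * x n + b * x' n) y = (\<lambda>S. a * vec_functional x y S + b * vec_functional x' y S)"
  by (auto simp: fun_eq_iff vec_functional_def Bl2_lincomb[OF S0_Bl2] inner_l2_lincomb_left)

text \<open>A duality argument: \<open>F\<close> is tested on \<open>vec_functional x y\<close>,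
  where \<open>y\<close> consists of the first \<open>N\<close> coordinates of
  \<open>op_of F x\<close> itself. The value is the squared norm of \<open>y\<close>, and
  boundedness of \<open>F\<close> makes it at most \<open>C * l2norm x\<close> times that
  norm.\<close>

lemma op_of_Bl2:
  assumes F: "F \<in> Bidual0"
  shows "op_of F \<in> Bl2"
proof -
  obtain C where C0: "0 \<le> C" and C: "\<And>f. f \<in> Dual0 \<Longrightarrow> cmod (F f) \<le> C * dnorm f"
    using Bidual0_bounded[OF F] by blast
  have b: "L2_set (\<lambda>n. cmod (op_of F x n)) {..<N} \<le> C * l2norm x" if x: "x \<in> l2" for x N
  proof -
    let ?z = "op_of F x" and ?L = "L2_set (\<lambda>n. cmod (op_of F x n)) {..<N}"
    define y where "y = vcut {..<N} ?z"
    have y: "y = (\<lambda>n. \<Sum>j<N. ?z j * basis_vec j n)" by (simp add: y_def vcut_lessThan)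
    have yl: "y \<in> l2" unfolding y by (intro l2_sum) simp
    have "?L\<^sup>2 = (\<Sum>n<N. (cmod (?z n))\<^sup>2)" by (simp add: L2_set_def sum_nonneg)
    then have "complex_of_real (?L\<^sup>2) = (\<Sum>n<N. ?z n * cnj (?z n))"
      by (simp only: of_real_sum complex_norm_square)
    also have "\<dots> = (\<Sum>n<N. cnj (?z n) * F (vec_functional x (basis_vec n)))"
      using x by (intro sum.cong) (simp_all add: op_of_def)
    also have "\<dots> = F (\<lambda>S. \<Sum>n<N. cnj (?z n) * vec_functional x (basis_vec n) S)"
      by (rule Bidual0_sum[OF F, symmetric]) (simp add: vec_functional_Dual0 x)
    \<comment> \<open>The conjugates are absorbed because \<open>vec_functional\<close> is conjugate
      linear in its second vector.\<close>
    also have "(\<lambda>S. \<Sum>n<N. cnj (?z n) * vec_functional x (basis_vec n) S) = vec_functional x y"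
      unfolding y by (auto simp: fun_eq_iff vec_functional_def inner_l2_sum_right)
    finally have "?L\<^sup>2 = cmod (F (vec_functional x y))"
      by (metis norm_of_real abs_of_nonneg zero_le_power2)
    also have "\<dots> \<le> C * dnorm (vec_functional x y)"
      by (intro C vec_functional_Dual0 x yl)
    also have "\<dots> \<le> C * (l2norm x * l2norm y)"
      by (intro mult_left_mono dnorm_vec_functional_le x yl C0)
    also have "l2norm y = ?L" by (simp add: y_def l2norm_vcut_lessThan)
    finally have "?L * ?L \<le> (C * l2norm x) * ?L" by (simp add: power2_eq_square mult_ac)
    then show ?thesis
      using C0 l2norm_nonneg[OF x] L2_set_nonneg[of "\<lambda>n. cmod (op_of F x n)" "{..<N}"]
      by (cases "?L = 0") (auto simp: mult_le_cancel_right)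
  qed
  show ?thesis
  proof (rule Bl2I)
    fix x y :: vec and a b assume x: "x \<in> l2" and y: "y \<in> l2"
    show "op_of F x \<in> l2" by (rule l2_boundI(1)[OF b[OF x]])
    show "l2norm (op_of F x) \<le> C * l2norm x" by (rule l2_boundI(2)[OF b[OF x]])
    show "op_of F (\<lambda>n. a * x n + b * y n) = (\<lambda>n. a * op_of F x n + b * op_of F y n)"
      using x y by (simp add: op_of_def l2_lincomb vec_functional_lincomb_left Bidual0_combination[OF F] vec_functional_Dual0)
  qed (simp add: op_of_def)
qed

text \<open>A truncation involves finitely many entries, so \<open>f\<close> composed with it is a
  finite combination of coordinate functionals. The last factor is the entry of
  \<open>center T\<close>.\<close>

lemma Dual0_trunc:
  assumes f: "f \<in> Dual0" and T: "T \<in> Bl2"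
  shows "f (trunc N T) = entry T (0, 0) * f idop +
    (\<Sum>p\<in>{..<N} \<times> {..<N} - {(0, 0)}. f (E (fst p) (snd p)) * (entry T p - entry T (0, 0) * entry idop p))"
proof -
  let ?A = "{..<N} \<times> {..<N} - {(0, 0)}" and ?K = "compress {..<N} {..<N} (center T)"
  have "?K = lincomb ?A (entry ?K)"
    using T by (intro finite_block_eq_lincomb compress_blocks) (simp_all add: entry_compress entry_center)
  then have "f ?K = (\<Sum>p\<in>?A. entry ?K p * f (E (fst p) (snd p)))"
    using Dual0_lincomb[OF f, of ?A "entry ?K"] by simp
  also have "\<dots> = (\<Sum>p\<in>?A. f (E (fst p) (snd p)) * (entry T p - entry T (0, 0) * entry idop p))"
    using T by (intro sum.cong) (auto simp: entry_compress center_def)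
  finally show ?thesis
    using T compress_center_K0[OF T, of N]
    by (simp add: trunc_def Dual0_add[OF f] Dual0_scale[OF f] S0_scale idop_S0 K0_S0)
qed

text \<open>Both functionals agree on the coordinate functionals. A finite combination
  \<open>g\<close> of these approximates \<open>f\<close> in the dual norm, with
  \<open>F g = f (trunc N (op_of F))\<close>, and both \<open>F\<close> and the pairing with
  \<open>op_of F\<close> are continuous enough to compare at \<open>f\<close>.\<close>

lemma bidual_of_op_of:
  assumes F: "F \<in> Bidual0"
  shows "bidual_of (op_of F) = F"
proof
  fix f
  let ?T = "op_of F"
  have T: "?T \<in> Bl2" by (rule op_of_Bl2[OF F])
  show "bidual_of ?T f = F f"
  proof (cases "f \<in> Dual0")
    case False
    then show ?thesis using F by (simp add: bidual_of_def Bidual0_def)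
  next
    case f: True
    obtain C where C0: "0 \<le> C" and C: "\<And>f. f \<in> Dual0 \<Longrightarrow> cmod (F f) \<le> C * dnorm f"
      using Bidual0_bounded[OF F] by blast
    have "cmod (F f - bidual_of ?T f) \<le> \<epsilon>" if "0 < \<epsilon>" for \<epsilon>
    proof -
      \<comment> \<open>The two errors are \<open>C * \<delta>\<close> for replacing
        \<open>f\<close> by \<open>g\<close> and \<open>\<delta> * opnorm ?T\<close> for truncating
        \<open>?T\<close>; the added 1 keeps the denominator positive.\<close>
      define \<delta> where "\<delta> = \<epsilon> / (C + opnorm ?T + 1)"
      have p: "0 < C + opnorm ?T + 1" using C0 opnorm_nonneg[OF T] by linarith
      have d: "0 < \<delta>" using that p by (simp add: \<delta>_def)
      obtain N where N: "\<And>T. T \<in> Bl2 \<Longrightarrow> cmod (bidual_of T f - f (trunc N T)) \<le> \<delta> * opnorm T"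
        using bidual_of_uniform_approx[OF f d] by blast
      let ?A = "{..<N} \<times> {..<N} - {(0, 0)}"
      define w where "w p = vec_functional (basis_vec (snd p)) (basis_vec (fst p))" for p
      \<comment> \<open>On \<open>S0\<close> this is \<open>f\<close> composed with
        \<open>trunc N\<close>, spelled out so that linearity of \<open>F\<close> applies; the
        factors 1 fit the two-term form of \<open>Bidual0_combination\<close>.\<close>
      define g where "g = (\<lambda>S. f idop * w (0, 0) S +
        1 * (\<Sum>p\<in>?A. f (E (fst p) (snd p)) * (1 * w p S + (- entry idop p) * w (0, 0) S)))"
      have w: "w p \<in> Dual0" for p by (simp add: w_def vec_functional_Dual0)
      have w2: "(\<lambda>S. 1 * w p S + (- entry idop p) * w (0, 0) S) \<in> Dual0" for p
        by (intro Dual0_linear_combination w)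
      have g: "g \<in> Dual0"
        unfolding g_def by (intro Dual0_linear_combination[OF w] Dual0_sum w2)
      have "F (w p) = entry ?T p" for p by (simp add: w_def op_of_def entry_def)
      then have "F g = f (trunc N ?T)"
        unfolding g_def Dual0_trunc[OF f T]
        by (subst Bidual0_combination[OF F w Dual0_sum[OF w2]], subst Bidual0_sum[OF F w2],
            subst Bidual0_combination[OF F w w]) (simp add: mult.commute)
      moreover have "cmod (F f - F g) \<le> C * \<delta>"
      proof -
        have "g S = f (trunc N S)" if "S \<in> S0" for S
          using that by (simp add: g_def w_def vec_functional_basis_vec Dual0_trunc[OF f] mult.commute)
        \<comment> \<open>On \<open>S0\<close> the pairing with \<open>f\<close> is evaluation, so
          the uniform approximation becomes a bound for the dual norm.\<close>
        then have "cmod (1 * f S + (- 1) * g S) \<le> \<delta> * opnorm S" if "S \<in> S0" for S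
          using N[of S] that by (simp add: bidual_of_S0 f)
        then have "dnorm (\<lambda>S. 1 * f S + (- 1) * g S) \<le> \<delta>"
          using d by (intro dnorm_least) auto
        then have "cmod (F (\<lambda>S. 1 * f S + (- 1) * g S)) \<le> C * \<delta>"
          using C[OF Dual0_linear_combination[OF f g, of 1 "-1"]] C0 by (meson mult_left_mono order_trans)
        then show ?thesis by (simp only: Bidual0_combination[OF F f g]) simp
      qed
      moreover have "cmod (f (trunc N ?T) - bidual_of ?T f) \<le> \<delta> * opnorm ?T"
        using N[OF T] by (simp add: norm_minus_commute)
      ultimately have "cmod (F f - bidual_of ?T f) \<le> C * \<delta> + \<delta> * opnorm ?T"
        using norm_triangle_ineq[of "F f - F g" "F g - bidual_of ?T f"] by simp
      also have "\<dots> \<le> (C + opnorm ?T + 1) * \<delta>" using d by (simp add: algebra_simps)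
      also have "\<dots> = \<epsilon>" using p by (simp add: \<delta>_def)
      finally show ?thesis .
    qed
    then have "cmod (F f - bidual_of ?T f) \<le> 0" by (rule field_le_epsilon[of _ 0, simplified])
    then show ?thesis by simp
  qed
qed

lemma bij_betw_bidual_of: "bij_betw bidual_of Bl2 Bidual0"
proof (rule bij_betwI')
  show "\<exists>T\<in>Bl2. F = bidual_of T" if "F \<in> Bidual0" for F
    using bidual_of_op_of[OF that] op_of_Bl2[OF that] by metis
qed (use inj_on_bidual_of bidual_of_Bidual0 in \<open>auto dest: inj_onD\<close>)

section \<open>Preservation of the matrix cones\<close>

lemma cnonneg_add: "cnonneg a \<Longrightarrow> cnonneg b \<Longrightarrow> cnonneg (a + b)"
  by (simp add: cnonneg_def)

lemma cnonneg_sum: "(\<And>i. i \<in> A \<Longrightarrow> cnonneg (f i)) \<Longrightarrow> cnonneg (\<Sum>i\<in>A. f i)"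
  by (simp add: cnonneg_def sum_nonneg)

lemma cnonneg_tendsto:
  assumes "f \<longlonglongrightarrow> l" "\<And>n. cnonneg (f n)"
  shows "cnonneg l"
proof -
  have "(\<lambda>n. Im (f n)) \<longlonglongrightarrow> Im l" "(\<lambda>n. Re (f n)) \<longlonglongrightarrow> Re l"
    using assms(1) by (auto intro: tendsto_intros)
  then show ?thesis
    using assms(2) LIMSEQ_le_const[of "\<lambda>n. Re (f n)" "Re l" 0]
    by (auto simp: cnonneg_def LIMSEQ_const_iff)
qed

lemma cnonneg_sums: "f sums l \<Longrightarrow> (\<And>n. cnonneg (f n)) \<Longrightarrow> cnonneg l"
  unfolding sums_def by (rule cnonneg_tendsto) (auto intro: cnonneg_sum)

text \<open>The form of the truncated matrix is the form of \<open>T\<close> on the heads of the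
  vectors plus the form of the scalar matrix of corner entries on their tails. The scalar matrix is
  positive because its form is that of \<open>T\<close> on multiples of
  \<open>basis_vec 0\<close>.\<close>

lemma pos_op_matrix_trunc:
  assumes "pos_op_matrix n T"
  shows "pos_op_matrix n (\<lambda>i j. trunc N (T i j))"
proof -
  have B: "T i j \<in> Bl2" if "i < n" "j < n" for i j using assms that by (simp add: pos_op_matrix_def)
  have pos: "cnonneg (\<Sum>i<n. \<Sum>j<n. inner_l2 (T i j (x j)) (x i))" if "\<And>i. i < n \<Longrightarrow> x i \<in> l2" for x
    using assms that by (simp add: pos_op_matrix_def)
  have "cnonneg (\<Sum>i<n. \<Sum>j<n. inner_l2 (trunc N (T i j) (x j)) (x i))" if x: "\<And>i. i < n \<Longrightarrow> x i \<in> l2" for x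
  proof -
    define t where "t i = vcut {N..} (x i)" for i
    have t: "t i \<in> l2" if "i < n" for i using x[OF that] by (simp add: t_def)
    \<comment> \<open>Expanding the inner products turns the tail contribution into a series over
      the coordinate \<open>k\<close> of values of one scalar form.\<close>
    have "(\<lambda>k. \<Sum>i<n. \<Sum>j<n. entry (T i j) (0, 0) * (t j k * cnj (t i k))) sums
        (\<Sum>i<n. \<Sum>j<n. entry (T i j) (0, 0) * inner_l2 (t j) (t i))"
      unfolding inner_l2_def
      by (intro sums_sum sums_mult summable_sums summable_inner t) auto
    moreover have "cnonneg (\<Sum>i<n. \<Sum>j<n. entry (T i j) (0, 0) * (t j k * cnj (t i k)))" for k
    proof -
      have "inner_l2 (T i j (\<lambda>m. t j k * basis_vec 0 m)) (\<lambda>m. t i k * basis_vec 0 m) =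
          entry (T i j) (0, 0) * (t j k * cnj (t i k))" if "i < n" "j < n" for i j
      proof -
        \<comment> \<open>Summands with coefficient 0 bring both arguments into the two-term form of
          the linearity lemmas.\<close>
        have "inner_l2 (T i j (\<lambda>m. t j k * basis_vec 0 m)) (\<lambda>m. t i k * basis_vec 0 m) =
            inner_l2 (\<lambda>m. t j k * T i j (basis_vec 0) m + 0 * T i j (basis_vec 0) m)
              (\<lambda>m. t i k * basis_vec 0 m + 0 * basis_vec 0 m)"
          using Bl2_scale[OF B[OF that] basis_vec_l2] by simp
        also have "\<dots> = t j k * (cnj (t i k) * inner_l2 (T i j (basis_vec 0)) (basis_vec 0))"
          using B[OF that] inner_l2_lincomb_right[of "T i j (basis_vec 0)" "basis_vec 0" "basis_vec 0" "t i k" 0]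
          by (subst inner_l2_lincomb_left) (simp_all add: l2_scale)
        finally show ?thesis by (simp add: inner_l2_basis_vec entry_def)
      qed
      then have "(\<Sum>i<n. \<Sum>j<n. entry (T i j) (0, 0) * (t j k * cnj (t i k))) =
          (\<Sum>i<n. \<Sum>j<n. inner_l2 (T i j (\<lambda>m. t j k * basis_vec 0 m)) (\<lambda>m. t i k * basis_vec 0 m))"
        by simp
      also have "cnonneg \<dots>" by (rule pos) (simp add: l2_scale)
      finally show ?thesis .
    qed
    ultimately have "cnonneg (\<Sum>i<n. \<Sum>j<n. entry (T i j) (0, 0) * inner_l2 (t j) (t i))"
      by (rule cnonneg_sums)
    moreover have "cnonneg (\<Sum>i<n. \<Sum>j<n. inner_l2 (T i j (vcut {..<N} (x j))) (vcut {..<N} (x i)))"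
      by (rule pos) (simp add: x)
    moreover have "(\<Sum>i<n. \<Sum>j<n. inner_l2 (trunc N (T i j) (x j)) (x i)) =
        (\<Sum>i<n. \<Sum>j<n. inner_l2 (T i j (vcut {..<N} (x j))) (vcut {..<N} (x i))) +
        (\<Sum>i<n. \<Sum>j<n. entry (T i j) (0, 0) * inner_l2 (t j) (t i))"
      using B x by (simp add: inner_l2_trunc t_def sum.distrib)
    ultimately show ?thesis by (simp add: cnonneg_add)
  qed
  then show ?thesis using B by (simp add: pos_op_matrix_def)
qed

text \<open>Pairing a matrix of operators with a matrix of functionals is summed in opposite orders
  on the two sides of the duality; this passes between them.\<close>

lemma sum_sum_swap_pairs:
  fixes g :: "'a \<Rightarrow> 'a \<Rightarrow> 'b \<Rightarrow> 'b \<Rightarrow> 'c::comm_monoid_add"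
  shows "(\<Sum>i\<in>A. \<Sum>j\<in>A. \<Sum>k\<in>B. \<Sum>l\<in>B. g i j k l) = (\<Sum>k\<in>B. \<Sum>l\<in>B. \<Sum>i\<in>A. \<Sum>j\<in>A. g i j k l)"
proof -
  have "(\<Sum>i\<in>A. \<Sum>j\<in>A. \<Sum>k\<in>B. \<Sum>l\<in>B. g i j k l) = (\<Sum>i\<in>A. \<Sum>k\<in>B. \<Sum>j\<in>A. \<Sum>l\<in>B. g i j k l)"
    by (rule sum.cong[OF refl], rule sum.swap)
  also have "\<dots> = (\<Sum>k\<in>B. \<Sum>i\<in>A. \<Sum>j\<in>A. \<Sum>l\<in>B. g i j k l)"
    by (rule sum.swap)
  also have "\<dots> = (\<Sum>k\<in>B. \<Sum>i\<in>A. \<Sum>l\<in>B. \<Sum>j\<in>A. g i j k l)"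
    by (rule sum.cong[OF refl], rule sum.cong[OF refl], rule sum.swap)
  also have "\<dots> = (\<Sum>k\<in>B. \<Sum>l\<in>B. \<Sum>i\<in>A. \<Sum>j\<in>A. g i j k l)"
    by (rule sum.cong[OF refl], rule sum.swap)
  finally show ?thesis .
qed

text \<open>Each truncated matrix lies in the cone of \<open>S0\<close>, so it pairs nonnegatively
  with a positive matrix of functionals, and the sign survives the limit.\<close>

lemma pos_Bidual0_bidual_of:
  assumes "pos_op_matrix n T"
  shows "pos_Bidual0 n (\<lambda>i j. bidual_of (T i j))"
proof -
  have B: "T i j \<in> Bl2" if "i < n" "j < n" for i j using assms that by (simp add: pos_op_matrix_def)
  have "cnonneg (\<Sum>i<n. \<Sum>j<n. \<Sum>k<m. \<Sum>l<m. cnj (v i k) * bidual_of (T i j) (f k l) * v j l)"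
    if f: "pos_Dual0 m f" for m f v
  proof (rule cnonneg_tendsto)
    have D: "f k l \<in> Dual0" if "k < m" "l < m" for k l using f that by (simp add: pos_Dual0_def)
    show "(\<lambda>N. \<Sum>i<n. \<Sum>j<n. \<Sum>k<m. \<Sum>l<m. cnj (v i k) * f k l (trunc N (T i j)) * v j l) \<longlonglongrightarrow>
        (\<Sum>i<n. \<Sum>j<n. \<Sum>k<m. \<Sum>l<m. cnj (v i k) * bidual_of (T i j) (f k l) * v j l)"
      by (intro tendsto_intros bidual_of_tendsto B D) auto
    fix N
    have "pos_S0 n (\<lambda>i j. trunc N (T i j))"
      using B pos_op_matrix_trunc[OF assms] by (simp add: pos_S0_def)
    \<comment> \<open>The test coefficients enter transposed, since the index of the functionals is
      now the outer one.\<close>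
    then have "cnonneg (\<Sum>k<m. \<Sum>l<m. \<Sum>i<n. \<Sum>j<n. cnj (v i k) * f k l (trunc N (T i j)) * v j l)"
      using f unfolding pos_Dual0_def by (auto dest!: spec[of _ "\<lambda>k i. v i k"])
    then show "cnonneg (\<Sum>i<n. \<Sum>j<n. \<Sum>k<m. \<Sum>l<m. cnj (v i k) * f k l (trunc N (T i j)) * v j l)"
      by (simp only: sum_sum_swap_pairs[of _ "{..<m}"])
  qed
  then show ?thesis using B by (simp add: pos_Bidual0_def bidual_of_Bidual0)
qed

text \<open>For \<open>X\<close> in the cone of \<open>S0\<close>, the sum over all four indices
  collapses to the form of \<open>X\<close> at the vectors \<open>y k\<close>, the combinations of
  the \<open>x i\<close> with coefficients \<open>v i k\<close>.\<close>

lemma pos_Dual0_vec_functional: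
  assumes x: "\<And>i. i < n \<Longrightarrow> x i \<in> l2"
  shows "pos_Dual0 n (\<lambda>i j. vec_functional (x j) (x i))"
proof -
  have "cnonneg (\<Sum>i<n. \<Sum>j<n. \<Sum>k<m. \<Sum>l<m. cnj (v i k) * vec_functional (x j) (x i) (X k l) * v j l)"
    if X: "pos_S0 m X" for m X v
  proof -
    define y where "y k = (\<lambda>p. \<Sum>i<n. v i k * x i p)" for k
    have y: "y k \<in> l2" for k unfolding y_def using x by (intro l2_sum) auto
    have inner_y: "inner_l2 z (y k) = (\<Sum>i<n. cnj (v i k) * inner_l2 z (x i))" if "z \<in> l2" for z k
      unfolding y_def using x that by (intro inner_l2_sum_right) auto
    have "inner_l2 (X k l (y l)) (y k) = (\<Sum>i<n. \<Sum>j<n. cnj (v i k) * vec_functional (x j) (x i) (X k l) * v j l)"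
      if "k < m" "l < m" for k l
    proof -
      have S: "X k l \<in> S0" using X that by (simp add: pos_S0_def)
      have "X k l (y l) = (\<lambda>p. \<Sum>j<n. v j l * X k l (x j) p)"
        unfolding y_def using x by (intro Bl2_sum[OF S0_Bl2[OF S]]) auto
      then have "inner_l2 (X k l (y l)) (y k) = (\<Sum>j<n. v j l * inner_l2 (X k l (x j)) (y k))"
        using y S by (simp add: inner_l2_sum_left)
      also have "\<dots> = (\<Sum>j<n. v j l * (\<Sum>i<n. cnj (v i k) * inner_l2 (X k l (x j)) (x i)))"
        using S by (simp add: inner_y)
      also have "\<dots> = (\<Sum>j<n. \<Sum>i<n. cnj (v i k) * vec_functional (x j) (x i) (X k l) * v j l)"
        using S by (simp add: sum_distrib_left vec_functional_def mult_ac)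
      also have "\<dots> = (\<Sum>i<n. \<Sum>j<n. cnj (v i k) * vec_functional (x j) (x i) (X k l) * v j l)"
        by (rule sum.swap)
      finally show ?thesis .
    qed
    moreover have "cnonneg (\<Sum>k<m. \<Sum>l<m. inner_l2 (X k l (y l)) (y k))"
      using X y by (simp add: pos_S0_def pos_op_matrix_def)
    ultimately show ?thesis
      by (simp add: sum_sum_swap_pairs[of _ "{..<m}" "{..<n}"])
  qed
  then show ?thesis using x by (simp add: pos_Dual0_def vec_functional_Dual0)
qed

text \<open>The forward direction tests against the positive matrix of vector functionals; the
  backward one is truncation and passage to the limit.\<close>

lemma pos_Bidual0_iff_pos_op_matrix:
  assumes B: "\<And>i j. i < n \<Longrightarrow> j < n \<Longrightarrow> T i j \<in> Bl2"
  shows "pos_Bidual0 n (\<lambda>i j. bidual_of (T i j)) \<longleftrightarrow> pos_op_matrix n T"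
proof
  assume pos: "pos_Bidual0 n (\<lambda>i j. bidual_of (T i j))"
  have "cnonneg (\<Sum>i<n. \<Sum>j<n. inner_l2 (T i j (x j)) (x i))" if x: "\<And>i. i < n \<Longrightarrow> x i \<in> l2" for x
  proof -
    \<comment> \<open>With the identity matrix as test coefficients only \<open>k = i\<close> and
      \<open>l = j\<close> survive, which leaves the form of \<open>T\<close> at
      \<open>x\<close>.\<close>
    let ?v = "\<lambda>i k :: nat. if i = k then 1 else 0 :: complex"
    have "cnonneg (\<Sum>i<n. \<Sum>j<n. \<Sum>k<n. \<Sum>l<n.
        cnj (?v i k) * bidual_of (T i j) (vec_functional (x l) (x k)) * ?v j l)"
      by (rule pos[unfolded pos_Bidual0_def, THEN conjunct2, rule_format, OF pos_Dual0_vec_functional[OF x]])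
    also have "(\<Sum>i<n. \<Sum>j<n. \<Sum>k<n. \<Sum>l<n.
        cnj (?v i k) * bidual_of (T i j) (vec_functional (x l) (x k)) * ?v j l) =
        (\<Sum>i<n. \<Sum>j<n. bidual_of (T i j) (vec_functional (x j) (x i)))"
    proof (rule sum.cong[OF refl], rule sum.cong[OF refl])
      fix i j assume "i \<in> {..<n}" "j \<in> {..<n}"
      have "(\<Sum>k<n. \<Sum>l<n. cnj (?v i k) * c k l * ?v j l) = (\<Sum>k<n. \<Sum>l<n. if j = l then if i = k then c k l else 0 else 0)"
        for c by (intro sum.cong) auto
      then show "(\<Sum>k<n. \<Sum>l<n. cnj (?v i k) * bidual_of (T i j) (vec_functional (x l) (x k)) * ?v j l) =
          bidual_of (T i j) (vec_functional (x j) (x i))"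
        using \<open>i \<in> {..<n}\<close> \<open>j \<in> {..<n}\<close> by (simp add: sum.delta')
    qed
    also have "\<dots> = (\<Sum>i<n. \<Sum>j<n. inner_l2 (T i j (x j)) (x i))"
      using B x by (simp add: bidual_of_vec_functional)
    finally show ?thesis .
  qed
  then show "pos_op_matrix n T" using B by (simp add: pos_op_matrix_def)
qed (rule pos_Bidual0_bidual_of)

section \<open>The unital complete order isomorphism\<close>

theorem theorem4p3:
  shows "\<exists>\<Phi>. ucoi_Bidual0_Bl2 \<Phi>"
proof
  \<comment> \<open>Linearity, unit and cones are established for \<open>bidual_of\<close> and
    carried over to its inverse.\<close>
  let ?\<Phi> = "inv_into Bl2 bidual_of"
  have Phi: "?\<Phi> F \<in> Bl2" "bidual_of (?\<Phi> F) = F" if "F \<in> Bidual0" for F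
    using bij_betw_bidual_of that by (auto simp: bij_betw_def inv_into_into f_inv_into_f)
  have Phi_bidual: "?\<Phi> (bidual_of T) = T" if "T \<in> Bl2" for T
    using inj_on_bidual_of that by simp
  have "?\<Phi> (\<lambda>f. a * F f + b * G f) = op_add (op_scale a (?\<Phi> F)) (op_scale b (?\<Phi> G))"
    if "F \<in> Bidual0" "G \<in> Bidual0" for F G a b
    using Phi_bidual[of "op_add (op_scale a (?\<Phi> F)) (op_scale b (?\<Phi> G))"] Phi[OF that(1)] Phi[OF that(2)]
    by (simp add: bidual_of_lincomb)
  moreover have "?\<Phi> unit_Bidual0 = idop"
  proof -
    have "bidual_of idop = unit_Bidual0"
      by (auto simp: fun_eq_iff unit_Bidual0_def bidual_of_S0 idop_S0) (simp add: bidual_of_def)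
    then show ?thesis using Phi_bidual[OF idop_Bl2] by simp
  qed
  moreover have "pos_Bidual0 n F \<longleftrightarrow> pos_op_matrix n (\<lambda>i j. ?\<Phi> (F i j))"
    if F: "\<And>i j. i < n \<Longrightarrow> j < n \<Longrightarrow> F i j \<in> Bidual0" for n F
  proof -
    have "pos_Bidual0 n F \<longleftrightarrow> pos_Bidual0 n (\<lambda>i j. bidual_of (?\<Phi> (F i j)))"
      using F by (simp add: pos_Bidual0_def Phi)
    also have "\<dots> \<longleftrightarrow> pos_op_matrix n (\<lambda>i j. ?\<Phi> (F i j))"
      using F by (intro pos_Bidual0_iff_pos_op_matrix Phi)
    finally show ?thesis .
  qed
  ultimately show "ucoi_Bidual0_Bl2 ?\<Phi>"
    using bij_betw_inv_into[OF bij_betw_bidual_of] by (simp add: ucoi_Bidual0_Bl2_def)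
qed

end
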